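(* Let $a\le A<B\le b$, $\alpha,\beta\in(0,1)$, $l\in\mathbb{R}$, and let $L,g:[a,b]\times\mathbb{R}^3\to\mathbb{R}$, $(x,y,u,v)\mapsto L(x,y,u,v)$, $(x,y,u,v)\mapsto g(x,y,u,v)$, have continuous first and second partial derivatives with respect to all their arguments. Put $$\mathcal{J}(y)=\int_A^B L\big(x,y(x),{_a\mathcal{D}_x^\alpha}y(x),{_x\mathcal{D}_b^\beta}y(x)\big)\,dx,\qquad \mathcal{I}(y)=\int_A^B g\big(x,y(x),{_a\mathcal{D}_x^\alpha}y(x),{_x\mathcal{D}_b^\beta}y(x)\big)\,dx$$ for admissible functions $y:[a,b]\to\mathbb{R}$. Let the admissible function $y$ be a local minimizer or a local maximizer of $\mathcal{J}$ subject to the boundary conditions $y(a)=y_a$, $y(b)=y_b$ and the isoperimetric constraint $\mathcal{I}(y)=l$, and let $L$, $g$ satisfy along $y$ the regularity conditions listed in the context. Then there exist two constants $\lambda_0,\lambda\in\mathbb{R}$, not both zero, such that, with $K=\lambda_0L-\lambda g$, $$\frac{\partial K}{\partial y}+{_x\mathcal{D}_B^\alpha}\frac{\partial K}{\partial u}+{_A\mathcal{D}_x^\beta}\frac{\partial K}{\partial v}=0\quad\text{for all }x\in[A,B],$$ $${_x\mathcal{D}_B^\alpha}\frac{\partial K}{\partial u}-{_x\mathcal{D}_A^\alpha}\frac{\partial K}{\partial u}=0\quad\text{for all }x\in[a,A],$$ $${_A\mathcal{D}_x^\beta}\frac{\partial K}{\partial v}-{_B\mathcal{D}_x^\beta}\frac{\partial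 K}{\partial v}=0\quad\text{for all }x\in[B,b],$$ where the partial derivatives of $K$ are evaluated at $\big(x,y(x),{_a\mathcal{D}_x^\alpha}y(x),{_x\mathcal{D}_b^\beta}y(x)\big)$.
   Context: For $\gamma\in(0,1)$, real numbers $c<d$ and a continuous function $f$, the left and right Riemann-Liouville fractional derivatives are $${_c\mathcal{D}_x^\gamma}f(x)=\frac{1}{\Gamma(1-\gamma)}\frac{d}{dx}\int_c^x (x-t)^{-\gamma}f(t)\,dt\quad (x>c),\qquad {_x\mathcal{D}_d^\gamma}f(x)=\frac{-1}{\Gamma(1-\gamma)}\frac{d}{dx}\int_x^d (t-x)^{-\gamma}f(t)\,dt\quad (x<d).$$ Saying that such a derivative is continuous on a closed interval means that it exists and extends continuously to the endpoint where the formula is not defined. Equations at endpoints of the intervals $[A,B]$, $[a,A]$, $[B,b]$ are understood as limits from inside the interval; the equation on $[a,A]$ is void if $a=A$, and the one on $[B,b]$ is void if $B=b$. Admissible functions: continuous $y:[a,b]\to\mathbb{R}$ such that ${_a\mathcal{D}_x^\alpha}y$ and ${_x\mathcal{D}_b^\beta}y$ are continuous on $[a,b]$. Each of these two requirements is imposed only if the corresponding derivative is present in the problem (i.e. $L$ or $g$ depends on $u$, respectively on $v$); if a derivative is not present, the corresponding argument is simply omitted. The prescribed boundary values satisfy $y_a=0$ if left fractional derivatives are present and $y_b=0$ if right fractional derivatives are present. Regularity conditions along $y$: $x\mapsto\frac{\partial L}{\partial u}$ and $x\mapsto\frac{\partial g}{\partial u}$, evaluated at $(x,y(x),{_a\mathcal{D}_x^\alpha}y(x),{_x\mathcal{D}_b^\beta}y(x))$,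 have continuous right fractional derivative ${_x\mathcal{D}_b^\alpha}$ on $[a,b]$, and $x\mapsto\frac{\partial L}{\partial v}$, $x\mapsto\frac{\partial g}{\partial v}$, evaluated at the same point, have continuous left fractional derivative ${_a\mathcal{D}_x^\beta}$ on $[a,b]$. Local extremum: fix a norm $\|\cdot\|$ on the linear space of admissible functions. $y$ is a local minimizer (resp. maximizer) of $\mathcal{J}$ subject to the boundary conditions and the constraint if $y$ is admissible and satisfies them, and there is $\delta>0$ such that $\mathcal{J}(y)\le\mathcal{J}(y_1)$ (resp. $\mathcal{J}(y)\ge\mathcal{J}(y_1)$) for all admissible $y_1$ satisfying the same boundary conditions and constraint with $\|y-y_1\|<\delta$. *)

theory Defs
  imports "HOL-Analysis.Analysis"
begin

text \<open>
  A function on an interval \<open>[c,d]\<close> is modelled by a total function whose values off \<open>[c,d]\<close> are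
  irrelevant. All derivatives are therefore taken within the domain: they are two-sided in its
  interior and one-sided at its end points.
\<close>

subsection \<open>Riemann-Liouville fractional derivatives\<close>

definition left_RL_formula :: "real \<Rightarrow> real \<Rightarrow> real \<Rightarrow> (real \<Rightarrow> real) \<Rightarrow> real \<Rightarrow> real" where
  "left_RL_formula \<gamma> c d f x = 1 / Gamma (1 - \<gamma>) *
     vector_derivative (\<lambda>s. integral {c..s} (\<lambda>t. (s - t) powr (- \<gamma>) * f t)) (at x within {c..d})"

definition right_RL_formula :: "real \<Rightarrow> real \<Rightarrow> real \<Rightarrow> (real \<Rightarrow> real) \<Rightarrow> real \<Rightarrow> real" where
  "right_RL_formula \<gamma> c d f x = - 1 / Gamma (1 - \<gamma>) *
     vector_derivative (\<lambda>s. integral {s..d} (\<lambda>t. (t - s) powr (- \<gamma>) * f t)) (at x within {c..d})"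

definition left_RL_exists :: "real \<Rightarrow> real \<Rightarrow> real \<Rightarrow> (real \<Rightarrow> real) \<Rightarrow> real \<Rightarrow> bool" where
  "left_RL_exists \<gamma> c d f x \<longleftrightarrow>
     (\<lambda>s. integral {c..s} (\<lambda>t. (s - t) powr (- \<gamma>) * f t)) differentiable (at x within {c..d})"

definition right_RL_exists :: "real \<Rightarrow> real \<Rightarrow> real \<Rightarrow> (real \<Rightarrow> real) \<Rightarrow> real \<Rightarrow> bool" where
  "right_RL_exists \<gamma> c d f x \<longleftrightarrow>
     (\<lambda>s. integral {s..d} (\<lambda>t. (t - s) powr (- \<gamma>) * f t)) differentiable (at x within {c..d})"

text \<open>
  The left derivative based at \<open>c\<close>, respectively the right derivative based at \<open>d\<close>, of a function on
  \<open>[c,d]\<close>; at the base point, where the formula is not defined, the value is the limit.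
\<close>

definition left_RL :: "real \<Rightarrow> real \<Rightarrow> real \<Rightarrow> (real \<Rightarrow> real) \<Rightarrow> real \<Rightarrow> real" where
  "left_RL \<gamma> c d f x =
     (if x = c then Lim (at_right c) (left_RL_formula \<gamma> c d f) else left_RL_formula \<gamma> c d f x)"

definition right_RL :: "real \<Rightarrow> real \<Rightarrow> real \<Rightarrow> (real \<Rightarrow> real) \<Rightarrow> real \<Rightarrow> real" where
  "right_RL \<gamma> c d f x =
     (if x = d then Lim (at_left d) (right_RL_formula \<gamma> c d f) else right_RL_formula \<gamma> c d f x)"

text \<open>Continuity at the base point contains the existence of the limit there.\<close>

definition continuous_left_RL :: "real \<Rightarrow> real \<Rightarrow> real \<Rightarrow> (real \<Rightarrow> real) \<Rightarrow> bool" where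
  "continuous_left_RL \<gamma> c d f \<longleftrightarrow>
     (\<forall>x\<in>{c<..d}. left_RL_exists \<gamma> c d f x) \<and> continuous_on {c..d} (left_RL \<gamma> c d f)"

definition continuous_right_RL :: "real \<Rightarrow> real \<Rightarrow> real \<Rightarrow> (real \<Rightarrow> real) \<Rightarrow> bool" where
  "continuous_right_RL \<gamma> c d f \<longleftrightarrow>
     (\<forall>x\<in>{c..<d}. right_RL_exists \<gamma> c d f x) \<and> continuous_on {c..d} (right_RL \<gamma> c d f)"


subsection \<open>Partial derivatives\<close>

definition has_partial :: "'a::euclidean_space set \<Rightarrow> 'a \<Rightarrow> ('a \<Rightarrow> real) \<Rightarrow> 'a \<Rightarrow> bool" where
  "has_partial S e F p \<longleftrightarrow>
     (\<lambda>t. F (p + t *\<^sub>R e)) differentiable (at 0 within {t. p + t *\<^sub>R e \<in> S})"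

definition partial :: "'a::euclidean_space set \<Rightarrow> 'a \<Rightarrow> ('a \<Rightarrow> real) \<Rightarrow> 'a \<Rightarrow> real" where
  "partial S e F p =
     vector_derivative (\<lambda>t. F (p + t *\<^sub>R e)) (at 0 within {t. p + t *\<^sub>R e \<in> S})"

definition C1_on :: "'a::euclidean_space set \<Rightarrow> ('a \<Rightarrow> real) \<Rightarrow> bool" where
  "C1_on S F \<longleftrightarrow>
     (\<forall>e\<in>Basis. (\<forall>p\<in>S. has_partial S e F p) \<and> continuous_on S (partial S e F))"

definition C2_on :: "'a::euclidean_space set \<Rightarrow> ('a \<Rightarrow> real) \<Rightarrow> bool" where
  "C2_on S F \<longleftrightarrow> C1_on S F \<and> (\<forall>e\<in>Basis. C1_on S (partial S e F))"

definition depends_on :: "'a::euclidean_space set \<Rightarrow> 'a \<Rightarrow> ('a \<Rightarrow> real) \<Rightarrow> bool" where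
  "depends_on S e F \<longleftrightarrow> (\<exists>p\<in>S. \<exists>t. p + t *\<^sub>R e \<in> S \<and> F (p + t *\<^sub>R e) \<noteq> F p)"


subsection \<open>The variational problem\<close>

text \<open>A point \<open>(x, y, u, v)\<close>; \<open>dir_y\<close>, \<open>dir_u\<close>, \<open>dir_v\<close> are the corresponding coordinate directions.\<close>

type_synonym point = "real \<times> real \<times> real \<times> real"

abbreviation dir_y :: point where "dir_y \<equiv> (0, 1, 0, 0)"
abbreviation dir_u :: point where "dir_u \<equiv> (0, 0, 1, 0)"
abbreviation dir_v :: point where "dir_v \<equiv> (0, 0, 0, 1)"

abbreviation strip :: "real \<Rightarrow> real \<Rightarrow> point set" where
  "strip a b \<equiv> {a..b} \<times> UNIV"

definition left_present :: "real \<Rightarrow> real \<Rightarrow> (point \<Rightarrow> real) \<Rightarrow> (point \<Rightarrow> real) \<Rightarrow> bool" where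
  "left_present a b L g \<longleftrightarrow> depends_on (strip a b) dir_u L \<or> depends_on (strip a b) dir_u g"

definition right_present :: "real \<Rightarrow> real \<Rightarrow> (point \<Rightarrow> real) \<Rightarrow> (point \<Rightarrow> real) \<Rightarrow> bool" where
  "right_present a b L g \<longleftrightarrow> depends_on (strip a b) dir_v L \<or> depends_on (strip a b) dir_v g"

text \<open>
  If a derivative is not present, it need not exist and the corresponding entry of \<open>along\<close> is an
  arbitrary number, which has no influence on \<open>L\<close>, \<open>g\<close> or their partial derivatives.
\<close>

definition along :: "real \<Rightarrow> real \<Rightarrow> real \<Rightarrow> real \<Rightarrow> (real \<Rightarrow> real) \<Rightarrow> real \<Rightarrow> point" where
  "along \<alpha> \<beta> a b y x = (x, y x, left_RL \<alpha> a b y x, right_RL \<beta> a b y x)"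

definition functional ::
  "real \<Rightarrow> real \<Rightarrow> real \<Rightarrow> real \<Rightarrow> real \<Rightarrow> real \<Rightarrow> (point \<Rightarrow> real) \<Rightarrow> (real \<Rightarrow> real) \<Rightarrow> real" where
  "functional \<alpha> \<beta> a b A B F y = integral {A..B} (\<lambda>x. F (along \<alpha> \<beta> a b y x))"

definition admissible ::
  "real \<Rightarrow> real \<Rightarrow> real \<Rightarrow> real \<Rightarrow> (point \<Rightarrow> real) \<Rightarrow> (point \<Rightarrow> real) \<Rightarrow> (real \<Rightarrow> real) set" where
  "admissible \<alpha> \<beta> a b L g = {y. continuous_on {a..b} y
     \<and> (left_present a b L g \<longrightarrow> continuous_left_RL \<alpha> a b y)
     \<and> (right_present a b L g \<longrightarrow> continuous_right_RL \<beta> a b y)}"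

text \<open>
  A norm on a linear space \<open>V\<close> of functions on \<open>[a,b]\<close>. The zero vector is any function vanishing on
  \<open>[a,b]\<close>; with the triangle inequality it follows that \<open>N\<close> ignores values off \<open>[a,b]\<close>.
\<close>

definition norm_on :: "real \<Rightarrow> real \<Rightarrow> (real \<Rightarrow> real) set \<Rightarrow> ((real \<Rightarrow> real) \<Rightarrow> real) \<Rightarrow> bool" where
  "norm_on a b V N \<longleftrightarrow>
     (\<forall>y\<in>V. 0 \<le> N y \<and> (N y = 0 \<longleftrightarrow> (\<forall>x\<in>{a..b}. y x = 0)))
     \<and> (\<forall>c. \<forall>y\<in>V. N (\<lambda>x. c * y x) = \<bar>c\<bar> * N y)
     \<and> (\<forall>y\<in>V. \<forall>z\<in>V. N (\<lambda>x. y x + z x) \<le> N y + N z)"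

definition local_minimizer ::
  "((real \<Rightarrow> real) \<Rightarrow> real) \<Rightarrow> (real \<Rightarrow> real) set \<Rightarrow> ((real \<Rightarrow> real) \<Rightarrow> real) \<Rightarrow> (real \<Rightarrow> real) \<Rightarrow> bool" where
  "local_minimizer N C J y \<longleftrightarrow>
     y \<in> C \<and> (\<exists>\<delta>>0. \<forall>y1\<in>C. N (\<lambda>x. y x - y1 x) < \<delta> \<longrightarrow> J y \<le> J y1)"

definition local_maximizer ::
  "((real \<Rightarrow> real) \<Rightarrow> real) \<Rightarrow> (real \<Rightarrow> real) set \<Rightarrow> ((real \<Rightarrow> real) \<Rightarrow> real) \<Rightarrow> (real \<Rightarrow> real) \<Rightarrow> bool" where
  "local_maximizer N C J y \<longleftrightarrow>
     y \<in> C \<and> (\<exists>\<delta>>0. \<forall>y1\<in>C. N (\<lambda>x. y x - y1 x) < \<delta> \<longrightarrow> J y \<ge> J y1)"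

definition regular_along ::
  "real \<Rightarrow> real \<Rightarrow> real \<Rightarrow> real \<Rightarrow> (point \<Rightarrow> real) \<Rightarrow> (real \<Rightarrow> real) \<Rightarrow> bool" where
  "regular_along \<alpha> \<beta> a b F y \<longleftrightarrow>
     continuous_right_RL \<alpha> a b (\<lambda>x. partial (strip a b) dir_u F (along \<alpha> \<beta> a b y x))
     \<and> continuous_left_RL \<beta> a b (\<lambda>x. partial (strip a b) dir_v F (along \<alpha> \<beta> a b y x))"

text \<open>
  \<open>E = 0\<close> on \<open>[c,d]\<close>, where the equation at the end points is a limit from inside; void if \<open>c = d\<close>.
\<close>

definition vanishes_on :: "real \<Rightarrow> real \<Rightarrow> (real \<Rightarrow> real) \<Rightarrow> bool" where
  "vanishes_on c d E \<longleftrightarrow> (c < d \<longrightarrow>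
     (\<forall>x\<in>{c<..<d}. E x = 0) \<and> (E \<longlongrightarrow> 0) (at_right c) \<and> (E \<longlongrightarrow> 0) (at_left d))"

end

theory Submission
  imports Defs
begin

text \<open>
  Only variations by the \<open>C\<^sup>1\<close> bumps \<open>bump p q\<close>, supported in \<open>[p,q]\<close>, are needed. For two of them the map
  \<open>(s,t) \<mapsto> (\<I>, \<J>)(y + s h\<^sub>1 + t h\<^sub>2)\<close> of the plane is differentiable at \<open>0\<close> and continuous; if its Jacobian were
  invertible it would map neighbourhoods of \<open>0\<close> to neighbourhoods, and \<open>y\<close> would not be extremal. So the first
  variations of \<open>\<J>\<close> and \<open>\<I>\<close> are proportional on bumps, and the multipliers are the proportionality constants.
  Fubini moves the fractional integrals in the first variation of \<open>K\<close> from the bump to \<open>\<partial>K/\<partial>u\<close> and \<open>\<partial>K/\<partial>v\<close>.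
  What results is \<open>\<integral>(\<Phi> h + \<Psi> h') = 0\<close> for every bump \<open>h\<close>, hence \<open>\<Phi> = \<Psi>'\<close>; the position of \<open>[p,q]\<close> relative to
  \<open>[A,B]\<close> decides which of the three equations this is. Since \<open>\<integral>\<^bsub>a\<^esub>\<^bsup>s\<^esup>\<close> and \<open>\<integral>\<^bsub>c\<^esub>\<^bsup>s\<^esup>\<close> of the kernel differ by a function
  that is smooth for \<open>s > c\<close>, regularity on \<open>[a,b]\<close> passes to the base points \<open>A\<close> and \<open>B\<close>.
\<close>

subsection \<open>Fractional integrals\<close>

text \<open>Moving the fractional derivatives themselves onto \<open>Ku\<close> and
  \<open>Kv\<close> would bring in derivatives based at \<open>A\<close> and \<open>B\<close>, which
  in general are unbounded near the base point. So the derivative stays on the variation: a bump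
  vanishes together with its derivative at the ends of its support, its Riemann-Liouville derivative
  is a fractional integral of \<open>bump_deriv\<close>, and only integrals with an integrable
  kernel have to be exchanged. Regularity enters afterwards, on open intervals, as the
  differentiability of \<Psi>.

  Two features of the problem shape the rest. The norm is arbitrary, with no link to uniform
  convergence; it is evaluated only on the plane spanned by two variations, where homogeneity and
  the triangle inequality control it. And an absent fractional derivative of \<open>y\<close> need
  not exist, so \<open>along\<close> may be discontinuous; analysis is done with such entries set to
  0.

  \<open>frac_left\<close> and \<open>frac_right\<close> are the Riemann-Liouville integrals of
  order \<open>1 - \<gamma>\<close> without the factor
  \<open>1 / Gamma (1 - \<gamma>)\<close>.\<close>

definition frac_left :: "real \<Rightarrow> real \<Rightarrow> (real \<Rightarrow> real) \<Rightarrow> real \<Rightarrow> real" where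
  "frac_left \<gamma> c f s = integral {c..s} (\<lambda>t. (s - t) powr (- \<gamma>) * f t)"

definition frac_right :: "real \<Rightarrow> real \<Rightarrow> (real \<Rightarrow> real) \<Rightarrow> real \<Rightarrow> real" where
  "frac_right \<gamma> d f s = integral {s..d} (\<lambda>t. (t - s) powr (- \<gamma>) * f t)"

lemma continuous_on_powr_nonneg:
  fixes f :: "'a::topological_space \<Rightarrow> real"
  assumes "continuous_on S f" "\<And>x. x \<in> S \<Longrightarrow> 0 \<le> f x" "0 < q"
  shows "continuous_on S (\<lambda>x. f x powr q)"
  using assms by (intro continuous_on_powr') auto

text \<open>The substitution \<open>t -> -t\<close>. Most right-sided facts on fractional integrals
  are reduced to the left-sided ones through it.\<close>

lemma frac_right_reflect: "frac_right \<gamma> d f s = frac_left \<gamma> (- d) (\<lambda>t. f (- t)) (- s)"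
proof -
  have "integral {-d..-s} (\<lambda>t. (- t - s) powr (- \<gamma>) * f (- t)) = integral {s..d} (\<lambda>t. (t - s) powr (- \<gamma>) * f t)"
    by (rule Henstock_Kurzweil_Integration.integral_reflect_real [of d s "\<lambda>t. (t - s) powr (- \<gamma>) * f t"])
  moreover have "- t - s = - s - t" for t by simp
  ultimately show ?thesis
    by (simp add: frac_left_def frac_right_def)
qed

text \<open>The substitution \<open>\<rho> = (s - t)\<^sup>1\<^sup>-\<^sup>\<gamma>\<close> removes the singularity of the kernel.\<close>

lemma has_integral_left_kernel:
  fixes f :: "real \<Rightarrow> real"
  assumes "0 < \<gamma>" "\<gamma> < 1" "c \<le> s" and f: "continuous_on {c..s} f"
  shows "((\<lambda>t. (s - t) powr (- \<gamma>) * f t) has_integral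
    1 / (1 - \<gamma>) * integral {0..(s - c) powr (1 - \<gamma>)} (\<lambda>\<rho>. f (s - \<rho> powr (1 / (1 - \<gamma>))))) {c..s}"
proof -
  let ?g = "\<lambda>t. (s - t) powr (1 - \<gamma>)"
  let ?g' = "\<lambda>t. - (1 - \<gamma>) * (s - t) powr (- \<gamma>)"
  let ?h = "\<lambda>\<rho>. f (s - \<rho> powr (1 / (1 - \<gamma>)))"
  let ?R = "(s - c) powr (1 - \<gamma>)"
  have inv: "((s - t) powr (1 - \<gamma>)) powr (1 / (1 - \<gamma>)) = s - t" if "t \<le> s" for t
    using that assms by (cases "t = s") (simp_all add: powr_powr)
  have le: "\<rho> powr (1 / (1 - \<gamma>)) \<le> s - c" if "0 \<le> \<rho>" "\<rho> \<le> ?R" for \<rho>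
  proof -
    have "\<rho> powr (1 / (1 - \<gamma>)) \<le> ?R powr (1 / (1 - \<gamma>))"
      using that assms by (intro powr_mono2) auto
    then show ?thesis using inv[of c] assms by simp
  qed
  \<comment> \<open>At \<open>t = s\<close> the substitution has infinite slope, so that point is
    exempted. As \<open>?g\<close> decreases, the first of the two integrals runs over an empty or
    one-point interval and only the second survives.\<close>
  have "((\<lambda>t. ?g' t *\<^sub>R ?h (?g t)) has_integral (integral {?g c..?g s} ?h - integral {?g s..?g c} ?h)) {c..s}"
  proof (rule has_integral_substitution_general[where s = "{s}" and c = 0 and d = ?R])
    show "?g ` {c..s} \<subseteq> {0..?R}"
      using assms by (auto intro!: powr_mono2)
    show "continuous_on {0..?R} ?h"
      using assms le
      by (intro continuous_on_compose2[OF f] continuous_on_diff continuous_on_powr_nonneg continuous_on_const continuous_on_id)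
        (force simp: algebra_simps)+
    show "continuous_on {c..s} ?g"
      using assms by (intro continuous_on_diff continuous_on_powr_nonneg continuous_on_const continuous_on_id) auto
    show "(?g has_real_derivative ?g' x) (at x within {c..s})" if "x \<in> {c..s} - {s}" for x
      using that assms by (auto intro!: derivative_eq_intros simp: algebra_simps)
  qed (use assms in auto)
  moreover have "integral {?g c..?g s} ?h = 0"
    using assms by (cases "c = s") (auto simp: integral_empty)
  ultimately have "((\<lambda>t. ?g' t * ?h (?g t)) has_integral - integral {0..?R} ?h) {c..s}"
    by simp
  then have "((\<lambda>t. (- 1 / (1 - \<gamma>)) * (?g' t * ?h (?g t))) has_integral (- 1 / (1 - \<gamma>)) * (- integral {0..?R} ?h)) {c..s}"
    by (rule has_integral_mult_right)
  then have "((\<lambda>t. (- 1 / (1 - \<gamma>)) * (?g' t * ?h (?g t))) has_integral 1 / (1 - \<gamma>) * integral {0..?R} ?h) {c..s}"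
    by simp
  then show ?thesis
  proof (rule has_integral_eq[rotated])
    fix t assume "t \<in> {c..s}"
    then have "?h (?g t) = f t" using inv[of t] by simp
    then show "(- 1 / (1 - \<gamma>)) * (?g' t * ?h (?g t)) = (s - t) powr (- \<gamma>) * f t"
      using assms by (simp add: field_simps)
  qed
qed

lemma frac_left_integrable:
  fixes f :: "real \<Rightarrow> real"
  assumes "0 < \<gamma>" "\<gamma> < 1" "continuous_on {c..s} f"
  shows "(\<lambda>t. (s - t) powr (- \<gamma>) * f t) integrable_on {c..s}"
proof (cases "c \<le> s")
  case True
  then show ?thesis using has_integral_left_kernel[of \<gamma> c s f] assms by blast
qed auto

lemma frac_right_integrable:
  fixes f :: "real \<Rightarrow> real"
  assumes "0 < \<gamma>" "\<gamma> < 1" and f: "continuous_on {s..d} f"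
  shows "(\<lambda>t. (t - s) powr (- \<gamma>) * f t) integrable_on {s..d}"
proof -
  have "continuous_on {-d..-s} (\<lambda>t. f (- t))"
    by (intro continuous_on_compose2[OF f] continuous_on_minus continuous_on_id) auto
  from frac_left_integrable[OF assms(1,2) this]
  have "(\<lambda>t. (- t - s) powr (- \<gamma>) * f (- t)) integrable_on {-d..-s}"
    by (simp only: minus_diff_commute)
  then show ?thesis
    using Henstock_Kurzweil_Integration.integrable_reflect_real[of "\<lambda>t. (t - s) powr (- \<gamma>) * f t" d s] by simp
qed

lemma frac_left_linear:
  assumes "0 < \<gamma>" "\<gamma> < 1" "continuous_on {c..s} f" "continuous_on {c..s} g"
  shows "frac_left \<gamma> c (\<lambda>t. p * f t + q * g t) s = p * frac_left \<gamma> c f s + q * frac_left \<gamma> c g s"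
proof -
  note i = frac_left_integrable[OF assms(1,2,3)] frac_left_integrable[OF assms(1,2,4)]
  have eq: "(\<lambda>t. (s - t) powr (- \<gamma>) * (p * f t + q * g t)) =
    (\<lambda>t. p * ((s - t) powr (- \<gamma>) * f t) + q * ((s - t) powr (- \<gamma>) * g t))"
    by (auto simp: algebra_simps)
  show ?thesis
    unfolding frac_left_def eq using i
    by (subst Henstock_Kurzweil_Integration.integral_add) (auto intro!: integrable_on_mult_right)
qed

lemma frac_right_linear:
  assumes "0 < \<gamma>" "\<gamma> < 1" "continuous_on {s..d} f" "continuous_on {s..d} g"
  shows "frac_right \<gamma> d (\<lambda>t. p * f t + q * g t) s = p * frac_right \<gamma> d f s + q * frac_right \<gamma> d g s"
  unfolding frac_right_reflect using assms
  by (intro frac_left_linear continuous_on_compose2[OF assms(3)] continuous_on_compose2[OF assms(4)] continuous_intros) auto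

text \<open>Beyond \<open>(s - a) powr (1 - \<gamma>)\<close> the argument of \<open>f\<close> lies
  left of \<open>a\<close>, where \<open>f\<close> is 0. The upper limit can thus be made
  independent of \<open>s\<close>, which leaves an ordinary parameter integral over a fixed compact
  interval.\<close>

lemma frac_left_vanishing:
  assumes "0 < \<gamma>" "\<gamma> < 1" "s \<in> {a..b}" and f: "continuous_on UNIV f" and 0: "\<And>t. t \<le> a \<Longrightarrow> f t = 0"
  shows "frac_left \<gamma> a f s = 1 / (1 - \<gamma>) * integral {0..(b - a) powr (1 - \<gamma>)} (\<lambda>\<rho>. f (s - \<rho> powr (1 / (1 - \<gamma>))))"
proof -
  let ?h = "\<lambda>\<rho>. f (s - \<rho> powr (1 / (1 - \<gamma>)))"
  have "?h \<rho> = 0" if "\<rho> > (s - a) powr (1 - \<gamma>)" for \<rho>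
  proof -
    have "((s - a) powr (1 - \<gamma>)) powr (1 / (1 - \<gamma>)) \<le> \<rho> powr (1 / (1 - \<gamma>))"
      using that assms by (intro powr_mono2) auto
    then have "s - a \<le> \<rho> powr (1 / (1 - \<gamma>))"
      using assms by (simp add: powr_powr)
    then show ?thesis by (intro 0) auto
  qed
  moreover have "(s - a) powr (1 - \<gamma>) \<le> (b - a) powr (1 - \<gamma>)"
    using assms by (intro powr_mono2) auto
  ultimately have "integral {0..(s - a) powr (1 - \<gamma>)} ?h = integral {0..(b - a) powr (1 - \<gamma>)} ?h"
    unfolding Henstock_Kurzweil_Integration.integral_restrict_UNIV[of "{0..(s - a) powr (1 - \<gamma>)}", symmetric]
      Henstock_Kurzweil_Integration.integral_restrict_UNIV[of "{0..(b - a) powr (1 - \<gamma>)}", symmetric]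
    by (intro arg_cong[where f = "integral UNIV"]) (auto simp: fun_eq_iff not_le)
  then show ?thesis
    unfolding frac_left_def
    using has_integral_left_kernel[of \<gamma> a s f] continuous_on_subset[OF f] assms
    by (simp add: integral_unique)
qed

lemma frac_left_vanishing_continuous:
  assumes "0 < \<gamma>" "\<gamma> < 1" and f: "continuous_on UNIV f" and 0: "\<And>t. t \<le> a \<Longrightarrow> f t = 0"
  shows "continuous_on {a..b} (frac_left \<gamma> a f)"
proof -
  have "continuous_on ({a..b} \<times> cbox 0 ((b - a) powr (1 - \<gamma>))) (\<lambda>(s, \<rho>). f (s - \<rho> powr (1 / (1 - \<gamma>))))"
    using assms unfolding split_beta
    by (intro continuous_on_compose2[OF f] continuous_on_diff continuous_on_powr_nonneg continuous_on_fst continuous_on_snd continuous_on_id) auto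
  then have "continuous_on {a..b} (\<lambda>s. 1 / (1 - \<gamma>) *
      integral (cbox 0 ((b - a) powr (1 - \<gamma>))) (\<lambda>\<rho>. f (s - \<rho> powr (1 / (1 - \<gamma>)))))"
    by (intro continuous_on_mult_left integral_continuous_on_param)
  then show ?thesis
    by (rule continuous_on_eq) (metis cbox_interval frac_left_vanishing[OF assms(1,2) _ f 0])
qed

text \<open>With fixed limits, \<open>s\<close> occurs only inside \<open>f\<close>, so
  differentiation passes to \<open>f\<close> without a boundary term. Since \<open>f\<close> is 0 at
  the base point, the Riemann-Liouville and Caputo derivatives coincide.\<close>

lemma frac_left_vanishing_derivative:
  assumes "0 < \<gamma>" "\<gamma> < 1" "s \<in> {a..b}"
    and d: "\<And>t. (f has_real_derivative f' t) (at t)" and f': "continuous_on UNIV f'"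
    and 0: "\<And>t. t \<le> a \<Longrightarrow> f t = 0" "\<And>t. t \<le> a \<Longrightarrow> f' t = 0"
  shows "(frac_left \<gamma> a f has_real_derivative frac_left \<gamma> a f' s) (at s within {a..b})"
proof -
  have f: "continuous_on UNIV f"
    using d by (meson DERIV_isCont continuous_at_imp_continuous_on)
  have "((\<lambda>s. integral (cbox 0 ((b - a) powr (1 - \<gamma>))) (\<lambda>\<rho>. f (s - \<rho> powr (1 / (1 - \<gamma>)))))
    has_real_derivative integral (cbox 0 ((b - a) powr (1 - \<gamma>))) (\<lambda>\<rho>. f' (s - \<rho> powr (1 / (1 - \<gamma>))))) (at s within {a..b})"
  proof (rule leibniz_rule_field_derivative)
    show "((\<lambda>s. f (s - \<rho> powr (1 / (1 - \<gamma>)))) has_real_derivative f' (x - \<rho> powr (1 / (1 - \<gamma>)))) (at x within {a..b})" for x \<rho>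
    proof -
      have "((\<lambda>s. s - \<rho> powr (1 / (1 - \<gamma>))) has_real_derivative 1) (at x within {a..b})"
        by (auto intro!: derivative_eq_intros)
      from DERIV_chain2[OF d this] show ?thesis by simp
    qed
    show "(\<lambda>\<rho>. f (x - \<rho> powr (1 / (1 - \<gamma>)))) integrable_on cbox 0 ((b - a) powr (1 - \<gamma>))" for x
      using assms
      by (intro integrable_continuous continuous_on_compose2[OF f] continuous_on_diff continuous_on_powr_nonneg continuous_on_const continuous_on_id) auto
    show "continuous_on ({a..b} \<times> cbox 0 ((b - a) powr (1 - \<gamma>))) (\<lambda>(x, \<rho>). f' (x - \<rho> powr (1 / (1 - \<gamma>))))"
      using assms unfolding split_beta
      by (intro continuous_on_compose2[OF f'] continuous_on_diff continuous_on_powr_nonneg continuous_on_fst continuous_on_snd continuous_on_id) auto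
  qed (use assms in auto)
  from DERIV_cmult[OF this, of "1 / (1 - \<gamma>)"]
  have "((\<lambda>s. 1 / (1 - \<gamma>) * integral {0..(b - a) powr (1 - \<gamma>)} (\<lambda>\<rho>. f (s - \<rho> powr (1 / (1 - \<gamma>)))))
    has_real_derivative frac_left \<gamma> a f' s) (at s within {a..b})"
    by (simp add: frac_left_vanishing[OF assms(1-3) f' 0(2)])
  then show ?thesis
    by (rule has_field_derivative_transform_within[where d = 1])
      (use assms in \<open>auto simp: frac_left_vanishing[OF assms(1,2) _ f 0(1)]\<close>)
qed

lemma has_real_derivative_reflect:
  assumes "(f has_real_derivative f') (at (- s) within uminus ` S)"
  shows "((\<lambda>s. f (- s)) has_real_derivative - f') (at s within S)"
proof -
  have "(uminus has_real_derivative - 1) (at s within S)"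
    by (auto intro!: derivative_eq_intros)
  from DERIV_image_chain[OF assms this] show ?thesis by (simp add: o_def)
qed

lemma frac_right_vanishing_continuous:
  assumes "0 < \<gamma>" "\<gamma> < 1" and f: "continuous_on UNIV f" and 0: "\<And>t. b \<le> t \<Longrightarrow> f t = 0"
  shows "continuous_on {a..b} (frac_right \<gamma> b f)"
  unfolding frac_right_reflect[abs_def]
proof (rule continuous_on_compose2[where t = "{-b..-a}" and f = uminus])
  show "continuous_on {-b..-a} (frac_left \<gamma> (- b) (\<lambda>t. f (- t)))"
    using assms by (intro frac_left_vanishing_continuous continuous_on_compose2[OF f] continuous_intros) auto
qed (auto intro!: continuous_intros)

lemma frac_right_vanishing_derivative:
  assumes "0 < \<gamma>" "\<gamma> < 1" "s \<in> {a..b}"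
    and d: "\<And>t. (f has_real_derivative f' t) (at t)" and f': "continuous_on UNIV f'"
    and 0: "\<And>t. b \<le> t \<Longrightarrow> f t = 0" "\<And>t. b \<le> t \<Longrightarrow> f' t = 0"
  shows "(frac_right \<gamma> b f has_real_derivative frac_right \<gamma> b f' s) (at s within {a..b})"
proof -
  have "((\<lambda>t. f (- t)) has_real_derivative - f' (- t)) (at t)" for t
    by (rule has_real_derivative_reflect[where f = f]) (auto intro: has_field_derivative_at_within d)
  moreover have "continuous_on UNIV (\<lambda>t. - f' (- t))"
    by (intro continuous_on_minus continuous_on_compose2[OF f'] continuous_on_id) auto
  ultimately have "(frac_left \<gamma> (- b) (\<lambda>t. f (- t)) has_real_derivative frac_left \<gamma> (- b) (\<lambda>t. - f' (- t)) (- s)) (at (- s) within {-b..-a})"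
    using assms by (intro frac_left_vanishing_derivative) auto
  from has_real_derivative_reflect[of "frac_left \<gamma> (- b) (\<lambda>t. f (- t))" _ s "{a..b}"] this
  have "((\<lambda>s. frac_left \<gamma> (- b) (\<lambda>t. f (- t)) (- s)) has_real_derivative - frac_left \<gamma> (- b) (\<lambda>t. - f' (- t)) (- s)) (at s within {a..b})"
    by simp
  moreover have "frac_left \<gamma> (- b) (\<lambda>t. - f' (- t)) (- s) = - frac_left \<gamma> (- b) (\<lambda>t. f' (- t)) (- s)"
    by (simp add: frac_left_def)
  ultimately show ?thesis
    by (simp add: frac_right_reflect[abs_def])
qed

section \<open>Changing the base point of a fractional integral\<close>

lemma left_kernel_derivative:
  fixes f :: "real \<Rightarrow> real"
  assumes f: "continuous_on {c..e} f" and "e < s"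
  shows "((\<lambda>s. integral {c..e} (\<lambda>t. (s - t) powr (- \<gamma>) * f t)) has_real_derivative
    integral {c..e} (\<lambda>t. - \<gamma> * (s - t) powr (- \<gamma> - 1) * f t)) (at s)"
proof -
  have "((\<lambda>s. integral (cbox c e) (\<lambda>t. (s - t) powr (- \<gamma>) * f t)) has_real_derivative
    integral (cbox c e) (\<lambda>t. - \<gamma> * (s - t) powr (- \<gamma> - 1) * f t)) (at s within {e<..})"
  proof (rule leibniz_rule_field_derivative)
    show "((\<lambda>x. (x - t) powr (- \<gamma>) * f t) has_real_derivative - \<gamma> * (x - t) powr (- \<gamma> - 1) * f t) (at x within {e<..})"
      if "x \<in> {e<..}" "t \<in> cbox c e" for x t
      using that by (auto intro!: derivative_eq_intros)
    show "(\<lambda>t. (x - t) powr (- \<gamma>) * f t) integrable_on cbox c e" if "x \<in> {e<..}" for x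
      using that f
      by (intro integrable_continuous continuous_on_mult continuous_on_powr continuous_on_diff
          continuous_on_id continuous_on_const) auto
    show "continuous_on ({e<..} \<times> cbox c e) (\<lambda>(x, t). - \<gamma> * (x - t) powr (- \<gamma> - 1) * f t)"
      unfolding split_beta
      by (intro continuous_on_mult continuous_on_powr continuous_on_diff continuous_on_compose2[OF f]
          continuous_on_fst continuous_on_snd continuous_on_id continuous_on_const) auto
  qed (use assms in auto)
  then show ?thesis using \<open>e < s\<close> by (simp add: at_within_open_NO_MATCH)
qed

lemma left_kernel_derivative_continuous:
  fixes f :: "real \<Rightarrow> real"
  assumes f: "continuous_on {c..e} f"
  shows "continuous_on {e<..} (\<lambda>s. integral {c..e} (\<lambda>t. - \<gamma> * (s - t) powr (- \<gamma> - 1) * f t))"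
proof -
  have "continuous_on ({e<..} \<times> cbox c e) (\<lambda>(s, t). - \<gamma> * (s - t) powr (- \<gamma> - 1) * f t)"
    unfolding split_beta
    by (intro continuous_on_mult continuous_on_powr continuous_on_diff continuous_on_compose2[OF f]
        continuous_on_fst continuous_on_snd continuous_on_id continuous_on_const) auto
  from integral_continuous_on_param[OF this] show ?thesis by simp
qed

text \<open>The difference is the integral of the kernel over \<open>[c,e]\<close>, an interval that
  the singularity \<open>t = s\<close> avoids for \<open>s > e\<close>. Only existence and
  continuity of the derivative matter later, so its formula is hidden.\<close>

lemma frac_left_truncate:
  assumes "0 < \<gamma>" "\<gamma> < 1" "c \<le> e" "e < d" and f: "continuous_on {c..d} f"
  obtains R' where "continuous_on {e<..<d} R'"
    "\<And>s. s \<in> {e<..<d} \<Longrightarrow> ((\<lambda>s. frac_left \<gamma> c f s - frac_left \<gamma> e f s) has_real_derivative R' s) (at s)"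
proof
  let ?R = "\<lambda>s. integral {c..e} (\<lambda>t. (s - t) powr (- \<gamma>) * f t)"
  let ?R' = "\<lambda>s. integral {c..e} (\<lambda>t. - \<gamma> * (s - t) powr (- \<gamma> - 1) * f t)"
  have fe: "continuous_on {c..e} f" using f \<open>e < d\<close> by (auto intro: continuous_on_subset)
  show "continuous_on {e<..<d} ?R'"
    by (rule continuous_on_subset[OF left_kernel_derivative_continuous[OF fe]]) auto
  fix s assume s: "s \<in> {e<..<d}"
  have "frac_left \<gamma> c f s - frac_left \<gamma> e f s = ?R s" if "s \<in> {e<..<d}" for s
  proof -
    have "(\<lambda>t. (s - t) powr (- \<gamma>) * f t) integrable_on {c..s}"
      using that assms by (intro frac_left_integrable) (auto intro: continuous_on_subset)
    then have "?R s + integral {e..s} (\<lambda>t. (s - t) powr (- \<gamma>) * f t) = frac_left \<gamma> c f s"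
      unfolding frac_left_def using that assms by (intro Henstock_Kurzweil_Integration.integral_combine) auto
    then show ?thesis by (simp add: frac_left_def)
  qed
  then show "((\<lambda>s. frac_left \<gamma> c f s - frac_left \<gamma> e f s) has_real_derivative ?R' s) (at s)"
    using s left_kernel_derivative[OF fe, of s \<gamma>]
    by (auto intro: has_field_derivative_transform_within_open[where S = "{e<..<d}" and f = ?R])
qed

lemma frac_right_truncate:
  assumes "0 < \<gamma>" "\<gamma> < 1" "e \<le> d" "c < e" and f: "continuous_on {c..d} f"
  obtains R' where "continuous_on {c<..<e} R'"
    "\<And>s. s \<in> {c<..<e} \<Longrightarrow> ((\<lambda>s. frac_right \<gamma> d f s - frac_right \<gamma> e f s) has_real_derivative R' s) (at s)"
proof -
  have "continuous_on {-d..-c} (\<lambda>t. f (- t))"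
    by (intro continuous_on_compose2[OF f] continuous_intros) auto
  from frac_left_truncate[OF assms(1,2) _ _ this, of "- e"] assms obtain R' where
    c: "continuous_on {-e<..<-c} R'" and
    d: "\<And>s. s \<in> {-e<..<-c} \<Longrightarrow> ((\<lambda>s. frac_left \<gamma> (- d) (\<lambda>t. f (- t)) s - frac_left \<gamma> (- e) (\<lambda>t. f (- t)) s) has_real_derivative R' s) (at s)"
    by auto
  show ?thesis
  proof
    show "continuous_on {c<..<e} (\<lambda>s. - R' (- s))"
      by (intro continuous_intros continuous_on_compose2[OF c]) auto
    show "((\<lambda>s. frac_right \<gamma> d f s - frac_right \<gamma> e f s) has_real_derivative - R' (- s)) (at s)"
      if "s \<in> {c<..<e}" for s
      using has_real_derivative_reflect[OF d[THEN has_field_derivative_at_within], of s UNIV] that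
      by (simp add: frac_right_reflect)
  qed
qed

subsection \<open>Exchanging the order of integration\<close>

text \<open>By translation invariance the integral of \<open>\<bar>k (x - t)\<bar>\<close> over
  \<open>t\<close> does not depend on \<open>x\<close>, so a constant multiple of
  \<open>\<bar>f x\<bar>\<close> dominates the inner integral of the absolute value and Fubini
  applies. The kernel may be singular: integrability is all that is asked of it.\<close>

lemma lborel_convolution_swap:
  fixes k f g :: "real \<Rightarrow> real"
  assumes k: "integrable lborel k" and f: "integrable lborel f"
    and g [measurable]: "g \<in> borel_measurable borel" and M: "\<And>t. \<bar>g t\<bar> \<le> M"
  shows "integrable lborel (\<lambda>x. f x * (\<integral>t. k (x - t) * g t \<partial>lborel))"
    and "integrable lborel (\<lambda>t. g t * (\<integral>x. k (x - t) * f x \<partial>lborel))"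
    and "(\<integral>x. f x * (\<integral>t. k (x - t) * g t \<partial>lborel) \<partial>lborel) =
      (\<integral>t. g t * (\<integral>x. k (x - t) * f x \<partial>lborel) \<partial>lborel)"
proof -
  have [measurable]: "k \<in> borel_measurable borel" "f \<in> borel_measurable borel"
    using k f by auto
  let ?H = "\<lambda>x t. f x * (k (x - t) * g t)"
  have shift: "integrable lborel (\<lambda>t. k (x - t))" for x
    using lborel_integrable_real_affine[OF k, of "-1" x] by simp
  have shift_eq: "(\<integral>t. \<bar>k (x - t)\<bar> \<partial>lborel) = (\<integral>t. \<bar>k t\<bar> \<partial>lborel)" for x
    using lborel_integral_real_affine[of "-1" "\<lambda>t. \<bar>k t\<bar>" x] by simp
  have kg: "integrable lborel (\<lambda>t. k (x - t) * g t)" for x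
  proof (rule Bochner_Integration.integrable_bound)
    show "integrable lborel (\<lambda>t. M * k (x - t))" using shift by simp
    have "\<bar>k (x - t) * g t\<bar> \<le> \<bar>M * k (x - t)\<bar>" for t
      using mult_right_mono[OF order_trans[OF M[of t] abs_ge_self], of "\<bar>k (x - t)\<bar>"] by (simp add: abs_mult mult.commute)
    then show "AE t in lborel. norm (k (x - t) * g t) \<le> norm (M * k (x - t))" by simp
  qed simp
  have H: "integrable (lborel \<Otimes>\<^sub>M lborel) (\<lambda>(x, t). ?H x t)"
  proof (rule lborel_pair.Fubini_integrable)
    show "integrable lborel (\<lambda>x. \<integral>t. norm (case (x, t) of (x, t) \<Rightarrow> ?H x t) \<partial>lborel)"
    proof (rule Bochner_Integration.integrable_bound)
      show "integrable lborel (\<lambda>x. f x * (M * (\<integral>t. \<bar>k t\<bar> \<partial>lborel)))"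
        using f by (intro integrable_mult_left)
      have "norm (\<integral>t. norm (?H x t) \<partial>lborel) \<le> norm (f x * (M * (\<integral>t. \<bar>k t\<bar> \<partial>lborel)))" for x
      proof -
        have "(\<integral>t. norm (?H x t) \<partial>lborel) \<le> (\<integral>t. (\<bar>f x\<bar> * M) * \<bar>k (x - t)\<bar> \<partial>lborel)"
        proof (rule integral_mono)
          show "integrable lborel (\<lambda>t. norm (?H x t))" using kg by simp
          show "integrable lborel (\<lambda>t. (\<bar>f x\<bar> * M) * \<bar>k (x - t)\<bar>)" using shift by simp
          have "\<bar>f x\<bar> * (\<bar>k (x - t)\<bar> * \<bar>g t\<bar>) \<le> \<bar>f x\<bar> * (\<bar>k (x - t)\<bar> * M)" for t
            by (intro mult_left_mono M) auto
          then show "norm (?H x t) \<le> (\<bar>f x\<bar> * M) * \<bar>k (x - t)\<bar>" for t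
            by (simp add: abs_mult mult.assoc mult.left_commute mult.commute)
        qed
        also have "\<dots> = \<bar>f x\<bar> * M * (\<integral>t. \<bar>k t\<bar> \<partial>lborel)"
          by (simp add: shift_eq)
        also have "\<dots> \<le> \<bar>f x * (M * (\<integral>t. \<bar>k t\<bar> \<partial>lborel))\<bar>"
          by (simp add: abs_mult mult.assoc mult_left_mono mult_right_mono)
        finally show ?thesis by simp
      qed
      then show "AE x in lborel. norm (\<integral>t. norm (case (x, t) of (x, t) \<Rightarrow> ?H x t) \<partial>lborel)
          \<le> norm (f x * (M * (\<integral>t. \<bar>k t\<bar> \<partial>lborel)))"
        by simp
    qed simp
    show "AE x in lborel. integrable lborel (\<lambda>t. case (x, t) of (x, t) \<Rightarrow> ?H x t)"
      using kg by simp
  qed simp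
  have eq: "?H x t = g t * (k (x - t) * f x)" for x t by simp
  show "integrable lborel (\<lambda>x. f x * (\<integral>t. k (x - t) * g t \<partial>lborel))"
    using lborel_pair.integrable_fst[OF H] by simp
  show "integrable lborel (\<lambda>t. g t * (\<integral>x. k (x - t) * f x \<partial>lborel))"
    using lborel_pair.integrable_snd[OF H] unfolding eq by simp
  show "(\<integral>x. f x * (\<integral>t. k (x - t) * g t \<partial>lborel) \<partial>lborel) =
      (\<integral>t. g t * (\<integral>x. k (x - t) * f x \<partial>lborel) \<partial>lborel)"
  proof -
    have "(\<integral>x. f x * (\<integral>t. k (x - t) * g t \<partial>lborel) \<partial>lborel) = (\<integral>x. (\<integral>t. ?H x t \<partial>lborel) \<partial>lborel)"
      by simp
    also have "\<dots> = (\<integral>t. (\<integral>x. ?H x t \<partial>lborel) \<partial>lborel)"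
      by (rule lborel_pair.Fubini_integral[OF H, symmetric])
    finally show ?thesis by (simp only: eq integral_mult_right_zero)
  qed
qed

text \<open>The singularity at 0 is integrable because \<open>\<gamma> < 1\<close>; the cut at
  \<open>M\<close> removes the tail, which for the same reason is not.\<close>

lemma integrable_lborel_kernel:
  assumes "\<gamma> < 1" "0 \<le> M"
  shows "integrable lborel (\<lambda>\<tau>. if \<tau> \<in> {0..M} then \<tau> powr (- \<gamma>) else 0 :: real)"
proof -
  have "(\<lambda>\<tau>. \<tau> powr (- \<gamma>)) absolutely_integrable_on {0..M}"
    using assms by (intro nonnegative_absolutely_integrable_1 integrable_on_powr_from_0) auto
  then have "integrable lebesgue (\<lambda>\<tau>. indicator {0..M} \<tau> *\<^sub>R \<tau> powr (- \<gamma>) :: real)"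
    by (simp add: set_integrable_def)
  \<comment> \<open>So far integrability holds for the completed measure; Borel measurability of the
    integrand carries it back to \<open>lborel\<close>.\<close>
  moreover have "(\<lambda>\<tau>. indicator {0..M} \<tau> *\<^sub>R \<tau> powr (- \<gamma>) :: real) \<in> borel_measurable lborel"
    by measurable
  ultimately have "integrable lborel (\<lambda>\<tau>. indicator {0..M} \<tau> *\<^sub>R \<tau> powr (- \<gamma>) :: real)"
    using integrable_completion by blast
  then show ?thesis
    by (rule Bochner_Integration.integrable_cong[THEN iffD1, rotated -1]) (auto simp: indicator_def)
qed

text \<open>Fractional integration by parts without derivatives: both sides integrate over the part
  of \<open>[p,q] \<times> [A,B]\<close> with \<open>t \<le> x\<close>. The two intervals are kept
  independent, and the resulting limit \<open>max t A\<close> is what later distinguishes the three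
  positions of \<open>[p,q]\<close>.\<close>

lemma frac_left_swap:
  assumes "0 < \<gamma>" "\<gamma> < 1" "a \<le> A" "B \<le> b" and f: "continuous_on {A..B} f"
    and g: "continuous_on UNIV g" and 0: "\<And>t. t \<notin> {p..q} \<Longrightarrow> g t = 0" and pq: "a \<le> p" "q \<le> b"
  shows "integral {A..B} (\<lambda>x. f x * frac_left \<gamma> a g x) =
    integral {p..q} (\<lambda>t. g t * integral {max t A..B} (\<lambda>x. (x - t) powr (- \<gamma>) * f x))"
proof (cases "p \<le> q \<and> A \<le> B")
  case True
  \<comment> \<open>The cut at 0 encodes \<open>t \<le> x\<close>. The cut at \<open>b - a\<close>
    makes the kernel integrable and loses nothing, since \<open>x - t \<le> b - a\<close> for
    \<open>x\<close> in \<open>[A,B]\<close> and \<open>t\<close> in \<open>[p,q]\<close>.\<close>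
  define k where "k = (\<lambda>\<tau>. if \<tau> \<in> {0..b - a} then \<tau> powr (- \<gamma>) else 0 :: real)"
  define F where "F = (\<lambda>x. if x \<in> {A..B} then f x else 0)"
  have k: "integrable lborel k"
    unfolding k_def using assms True by (intro integrable_lborel_kernel) auto
  have "integrable lborel (\<lambda>x. indicator {A..B} x *\<^sub>R f x)"
    by (intro borel_integrable_compact f compact_Icc)
  then have F: "integrable lborel F"
    by (rule Bochner_Integration.integrable_cong[THEN iffD1, rotated -1]) (auto simp: F_def indicator_def)
  have [measurable]: "k \<in> borel_measurable borel" "F \<in> borel_measurable borel"
    using k F by auto
  have gm [measurable]: "g \<in> borel_measurable borel"
    using g by (simp add: borel_measurable_continuous_onI)
  have "bounded (g ` {p..q})"
    using g by (intro compact_imp_bounded compact_continuous_image) (auto intro: continuous_on_subset)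
  then obtain M where "\<And>t. t \<in> {p..q} \<Longrightarrow> \<bar>g t\<bar> \<le> M" "0 < M"
    unfolding bounded_pos by (metis imageI real_norm_def)
  then have M: "\<bar>g t\<bar> \<le> M" for t using 0[of t] by (cases "t \<in> {p..q}") auto
  note swap = lborel_convolution_swap[OF k F gm M]
  have left: "(\<integral>t. k (x - t) * g t \<partial>lborel) = frac_left \<gamma> a g x" if "x \<in> {A..B}" for x
  proof -
    have "integrable lborel (\<lambda>t. k (x - t) * g t)"
    proof (rule Bochner_Integration.integrable_bound)
      show "integrable lborel (\<lambda>t. M * k (x - t))"
        using lborel_integrable_real_affine[OF k, of "-1" x] by simp
      have "\<bar>k (x - t) * g t\<bar> \<le> \<bar>M * k (x - t)\<bar>" for t
        using mult_right_mono[OF order_trans[OF M[of t] abs_ge_self], of "\<bar>k (x - t)\<bar>"] by (simp add: abs_mult mult.commute)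
      then show "AE t in lborel. norm (k (x - t) * g t) \<le> norm (M * k (x - t))" by simp
    qed simp
    then have "(\<integral>t. k (x - t) * g t \<partial>lborel) = integral UNIV (\<lambda>t. k (x - t) * g t)"
      by (rule integral_lborel[symmetric])
    also have "\<dots> = integral UNIV (\<lambda>t. if t \<in> {a..x} then (x - t) powr (- \<gamma>) * g t else 0)"
    proof (rule arg_cong[where f = "integral UNIV"], rule ext)
      fix t
      show "k (x - t) * g t = (if t \<in> {a..x} then (x - t) powr (- \<gamma>) * g t else 0)"
        using that assms 0[of t] by (cases "t \<in> {p..q}") (auto simp: k_def)
    qed
    finally show ?thesis
      by (simp only: Henstock_Kurzweil_Integration.integral_restrict_UNIV frac_left_def)
  qed
  have right: "(\<integral>x. k (x - t) * F x \<partial>lborel) = integral {max t A..B} (\<lambda>x. (x - t) powr (- \<gamma>) * f x)"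
    if "t \<in> {p..q}" for t
  proof -
    have "bounded (f ` {A..B})"
      using f by (intro compact_imp_bounded compact_continuous_image) auto
    then obtain C where "\<And>t. t \<in> {A..B} \<Longrightarrow> \<bar>f t\<bar> \<le> C" "0 < C"
      unfolding bounded_pos by (metis imageI real_norm_def)
    then have C: "\<bar>F x\<bar> \<le> C" for x by (auto simp: F_def)
    have "integrable lborel (\<lambda>x. k (x - t) * F x)"
    proof (rule Bochner_Integration.integrable_bound)
      show "integrable lborel (\<lambda>x. C * k (x - t))"
        using lborel_integrable_real_affine[OF k, of "1" "- t"] by simp
      have "\<bar>k (x - t) * F x\<bar> \<le> \<bar>C * k (x - t)\<bar>" for x
        using mult_right_mono[OF order_trans[OF C[of x] abs_ge_self], of "\<bar>k (x - t)\<bar>"] by (simp add: abs_mult mult.commute)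
      then show "AE x in lborel. norm (k (x - t) * F x) \<le> norm (C * k (x - t))" by simp
    qed simp
    then have "(\<integral>x. k (x - t) * F x \<partial>lborel) = integral UNIV (\<lambda>x. k (x - t) * F x)"
      by (rule integral_lborel[symmetric])
    also have "\<dots> = integral UNIV (\<lambda>x. if x \<in> {max t A..B} then (x - t) powr (- \<gamma>) * f x else 0)"
      using that assms by (intro arg_cong[where f = "integral UNIV"]) (auto simp: k_def F_def fun_eq_iff)
    finally show ?thesis
      by (simp only: Henstock_Kurzweil_Integration.integral_restrict_UNIV)
  qed
  have "integral {A..B} (\<lambda>x. f x * frac_left \<gamma> a g x) = integral UNIV (\<lambda>x. F x * (\<integral>t. k (x - t) * g t \<partial>lborel))"
    unfolding Henstock_Kurzweil_Integration.integral_restrict_UNIV[of "{A..B}", symmetric]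
    by (intro arg_cong[where f = "integral UNIV"]) (auto simp: fun_eq_iff F_def left)
  also have "\<dots> = integral UNIV (\<lambda>t. g t * (\<integral>x. k (x - t) * F x \<partial>lborel))"
    unfolding integral_lborel[OF swap(1)] integral_lborel[OF swap(2)] by (rule swap(3))
  also have "\<dots> = integral {p..q} (\<lambda>t. g t * integral {max t A..B} (\<lambda>x. (x - t) powr (- \<gamma>) * f x))"
    unfolding Henstock_Kurzweil_Integration.integral_restrict_UNIV[of "{p..q}", symmetric]
    by (intro arg_cong[where f = "integral UNIV"] ext) (simp add: 0 right)
  finally show ?thesis .
next
  case False
  then consider "p > q" | "A > B" by linarith
  then show ?thesis
  proof cases
    case 1
    then have "g = (\<lambda>_. 0)" using 0 by auto
    then show ?thesis by (simp add: frac_left_def)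
  next
    case 2
    then show ?thesis by simp
  qed
qed

lemma frac_right_swap:
  assumes "0 < \<gamma>" "\<gamma> < 1" "a \<le> A" "B \<le> b" and f: "continuous_on {A..B} f"
    and g: "continuous_on UNIV g" and 0: "\<And>t. t \<notin> {p..q} \<Longrightarrow> g t = 0" and pq: "a \<le> p" "q \<le> b"
  shows "integral {A..B} (\<lambda>x. f x * frac_right \<gamma> b g x) =
    integral {p..q} (\<lambda>t. g t * integral {A..min t B} (\<lambda>x. (t - x) powr (- \<gamma>) * f x))"
proof -
  note reflect = Henstock_Kurzweil_Integration.integral_reflect_real
  have "integral {A..B} (\<lambda>x. f x * frac_right \<gamma> b g x) = integral {-B..-A} (\<lambda>x. f (- x) * frac_left \<gamma> (- b) (\<lambda>t. g (- t)) x)"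
    unfolding frac_right_reflect
    using reflect[of B A "\<lambda>x. f x * frac_left \<gamma> (- b) (\<lambda>t. g (- t)) (- x)"] by simp
  also have "\<dots> = integral {-q..-p} (\<lambda>t. g (- t) * integral {max t (- B)..- A} (\<lambda>x. (x - t) powr (- \<gamma>) * f (- x)))"
    using assms
    by (intro frac_left_swap[where b = "- a"] continuous_on_compose2[OF f] continuous_on_compose2[OF g]
        continuous_on_minus continuous_on_id) auto
  also have "(\<lambda>t. g (- t) * integral {max t (- B)..- A} (\<lambda>x. (x - t) powr (- \<gamma>) * f (- x))) =
      (\<lambda>t. g (- t) * integral {A..min (- t) B} (\<lambda>x. (- t - x) powr (- \<gamma>) * f x))"
  proof (rule ext)
    fix t
    have "max t (- B) = - min (- t) B" by simp
    then show "g (- t) * integral {max t (- B)..- A} (\<lambda>x. (x - t) powr (- \<gamma>) * f (- x)) =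
        g (- t) * integral {A..min (- t) B} (\<lambda>x. (- t - x) powr (- \<gamma>) * f x)"
      using reflect[of "min (- t) B" A "\<lambda>x. (- t - x) powr (- \<gamma>) * f x"] by (simp add: algebra_simps)
  qed
  also have "integral {-q..-p} (\<lambda>t. g (- t) * integral {A..min (- t) B} (\<lambda>x. (- t - x) powr (- \<gamma>) * f x)) =
      integral {p..q} (\<lambda>t. g t * integral {A..min t B} (\<lambda>x. (t - x) powr (- \<gamma>) * f x))"
    by (rule reflect)
  finally show ?thesis .
qed

subsection \<open>The fundamental lemma for bumps\<close>

text \<open>The square makes the positive part of the parabola continuously differentiable across
  \<open>p\<close> and \<open>q\<close>, with the explicit derivative
  \<open>bump_deriv\<close>.\<close>

definition bump :: "real \<Rightarrow> real \<Rightarrow> real \<Rightarrow> real" where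
  "bump p q t = (max 0 ((t - p) * (q - t)))\<^sup>2"

definition bump_deriv :: "real \<Rightarrow> real \<Rightarrow> real \<Rightarrow> real" where
  "bump_deriv p q t = 2 * max 0 ((t - p) * (q - t)) * (p + q - 2 * t)"

lemma has_real_derivative_max_0_square:
  "((\<lambda>r::real. (max 0 r)\<^sup>2) has_real_derivative 2 * max 0 r) (at r)"
proof -
  consider "r > 0" | "r < 0" | "r = 0" by linarith
  then show ?thesis
  proof cases
    case 1
    have "((\<lambda>r::real. r\<^sup>2) has_real_derivative 2 * r) (at r)"
      by (auto intro!: derivative_eq_intros)
    then show ?thesis
      using 1 by (auto intro: has_field_derivative_transform_within_open[where S = "{0<..}" and f = "\<lambda>r. r\<^sup>2"])
  next
    case 2
    have "((\<lambda>r::real. 0) has_real_derivative 0) (at r)" by simp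
    then show ?thesis
      using 2 by (auto intro: has_field_derivative_transform_within_open[where S = "{..<0}" and f = "\<lambda>r. 0"])
  next
    case 3
    have "((\<lambda>h::real. (max 0 h)\<^sup>2 / h) \<longlongrightarrow> 0) (at 0)"
    proof (rule tendsto_rabs_zero_cancel, rule tendsto_sandwich[where f = "\<lambda>_. 0"])
      show "\<forall>\<^sub>F h::real in at 0. \<bar>(max 0 h)\<^sup>2 / h\<bar> \<le> \<bar>h\<bar>"
        by (intro always_eventually allI) (auto simp: max_def power2_eq_square)
      show "((\<lambda>h::real. \<bar>h\<bar>) \<longlongrightarrow> 0) (at 0)"
        by (rule tendsto_rabs_zero) (rule tendsto_ident_at)
    qed auto
    then show ?thesis using 3 by (simp add: has_field_derivative_iff)
  qed
qed

lemma bump_derivative: "(bump p q has_real_derivative bump_deriv p q t) (at t)"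
proof -
  have "((\<lambda>t. (t - p) * (q - t)) has_real_derivative (p + q - 2 * t)) (at t)"
    by (auto intro!: derivative_eq_intros simp: algebra_simps)
  from DERIV_chain2[OF has_real_derivative_max_0_square this] show ?thesis
    by (simp add: bump_def[abs_def] bump_deriv_def)
qed

lemma continuous_on_bump_deriv: "continuous_on S (bump_deriv p q)"
  unfolding bump_deriv_def[abs_def] by (intro continuous_intros)

lemma continuous_on_bump: "continuous_on S (bump p q)"
  unfolding bump_def[abs_def] by (intro continuous_intros)

lemma bump_outside:
  assumes "p \<le> q" "t \<notin> {p<..<q}"
  shows "bump p q t = 0" "bump_deriv p q t = 0"
proof -
  have "(t - p) * (q - t) \<le> 0"
    using assms by (auto simp: mult_le_0_iff)
  then show "bump p q t = 0" "bump_deriv p q t = 0"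
    by (simp_all add: bump_def bump_deriv_def max_def)
qed

lemma bump_nonneg: "0 \<le> bump p q t"
  by (simp add: bump_def)

lemma bump_pos: "p < t \<Longrightarrow> t < q \<Longrightarrow> 0 < bump p q t"
  by (simp add: bump_def max_def mult_pos_pos not_le)

text \<open>The case of du Bois-Reymond's lemma in which \<open>\<Psi>\<close> is already known to
  be continuously differentiable: integration by parts leaves
  \<open>(\<Phi> - \<Psi>') * bump\<close>, whose integral cannot vanish for a bump supported where
  the first factor has one sign.\<close>

lemma du_bois_reymond_bump:
  assumes \<Phi>: "continuous_on {c<..<d} \<Phi>" and \<Psi>': "continuous_on {c<..<d} \<Psi>'"
    and \<Psi>: "\<And>t. t \<in> {c<..<d} \<Longrightarrow> (\<Psi> has_real_derivative \<Psi>' t) (at t)"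
    and int: "\<And>p q. c < p \<Longrightarrow> p < q \<Longrightarrow> q < d \<Longrightarrow>
      integral {p..q} (\<lambda>t. \<Phi> t * bump p q t + \<Psi> t * bump_deriv p q t) = 0"
    and x: "x \<in> {c<..<d}"
  shows "\<Phi> x = \<Psi>' x"
proof (rule ccontr)
  assume neq: "\<Phi> x \<noteq> \<Psi>' x"
  \<comment> \<open>The sign factor makes \<open>h\<close> positive at \<open>x\<close> and merges
    the two possible signs of the difference.\<close>
  define h where "h t = sgn (\<Phi> x - \<Psi>' x) * (\<Phi> t - \<Psi>' t)" for t
  have hx: "0 < h x" using neq by (simp add: h_def sgn_if)
  have hc: "continuous_on {c<..<d} h"
    unfolding h_def by (intro continuous_intros \<Phi> \<Psi>')
  then have "open (h -` {0<..} \<inter> {c<..<d})"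
    using continuous_open_preimage[of "{c<..<d}" h "{0<..}"] by (simp add: Int_commute)
  moreover have "x \<in> h -` {0<..} \<inter> {c<..<d}" using x hx by auto
  ultimately obtain e where "0 < e" and e: "cball x e \<subseteq> h -` {0<..} \<inter> {c<..<d}"
    using open_contains_cball by blast
  define p q where "p = x - e" and "q = x + e"
  have pq: "p < x" "x < q" "p < q" using \<open>0 < e\<close> by (auto simp: p_def q_def)
  have sub: "h t > 0 \<and> t \<in> {c<..<d}" if "t \<in> {p..q}" for t
    using that e by (auto simp: p_def q_def cball_def dist_real_def subset_iff)
  then have subs: "{p..q} \<subseteq> {c<..<d}" by auto
  have "c < p" "q < d" using sub[of p] sub[of q] pq by auto
  have "((\<lambda>t. \<Psi>' t * bump p q t + bump_deriv p q t * \<Psi> t) has_integral \<Psi> q * bump p q q - \<Psi> p * bump p q p) {p..q}"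
  proof (rule fundamental_theorem_of_calculus)
    fix t assume "t \<in> {p..q}"
    then have "((\<lambda>t. \<Psi> t * bump p q t) has_real_derivative \<Psi>' t * bump p q t + bump_deriv p q t * \<Psi> t) (at t)"
      using sub by (intro DERIV_mult \<Psi> bump_derivative) blast
    then show "((\<lambda>t. \<Psi> t * bump p q t) has_vector_derivative \<Psi>' t * bump p q t + bump_deriv p q t * \<Psi> t) (at t within {p..q})"
      by (simp add: has_real_derivative_iff_has_vector_derivative has_vector_derivative_at_within)
  qed (use pq in simp)
  then have 1: "((\<lambda>t. \<Psi>' t * bump p q t + \<Psi> t * bump_deriv p q t) has_integral 0) {p..q}"
    by (simp add: bump_outside mult.commute less_imp_le[OF pq(3)])
  have \<Psi>c: "continuous_on {p..q} \<Psi>"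
    using \<Psi> sub by (meson DERIV_isCont continuous_at_imp_continuous_on)
  have "((\<lambda>t. \<Phi> t * bump p q t + \<Psi> t * bump_deriv p q t) has_integral 0) {p..q}"
    unfolding int[OF \<open>c < p\<close> \<open>p < q\<close> \<open>q < d\<close>, symmetric]
    by (intro integrable_integral integrable_continuous_interval continuous_on_add continuous_on_mult
        continuous_on_subset[OF \<Phi> subs] \<Psi>c continuous_on_bump continuous_on_bump_deriv)
  from has_integral_mult_right[OF has_integral_diff[OF this 1], of "sgn (\<Phi> x - \<Psi>' x)"]
  have "((\<lambda>t. h t * bump p q t) has_integral 0) {p..q}"
    by (simp add: h_def algebra_simps)
  moreover have "continuous_on (cbox p q) (\<lambda>t. h t * bump p q t)"
    using subs by (intro continuous_on_mult continuous_on_bump continuous_on_subset[OF hc]) auto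
  ultimately have "h x * bump p q x = 0"
    using pq sub
    by (intro has_integral_0_cbox_imp_0[of p q "\<lambda>t. h t * bump p q t"])
      (auto intro!: mult_nonneg_nonneg bump_nonneg simp: less_imp_le)
  then show False using hx bump_pos[OF pq(1,2)] by simp
qed

subsection \<open>Continuously differentiable functions on the strip\<close>

lemma has_partial_derivative:
  assumes "has_partial S e F p"
  shows "((\<lambda>t. F (p + t *\<^sub>R e)) has_real_derivative partial S e F p) (at 0 within {t. p + t *\<^sub>R e \<in> S})"
  using assms unfolding has_partial_def partial_def has_real_derivative_iff_has_vector_derivative
  by (simp add: vector_derivative_works)

lemma C1_on_partial_derivative:
  assumes "C1_on S F" "e \<in> Basis" "p \<in> S"
  shows "((\<lambda>t. F (p + t *\<^sub>R e)) has_real_derivative partial S e F p) (at 0 within {t. p + t *\<^sub>R e \<in> S})"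
  using assms by (intro has_partial_derivative) (auto simp: C1_on_def)

lemma real_derivative_translate:
  fixes f :: "real \<Rightarrow> real"
  assumes "((\<lambda>t. f (x + t)) has_real_derivative d) (at 0 within {t. x + t \<in> S})"
  shows "(f has_real_derivative d) (at x within S)"
proof -
  have im: "(\<lambda>s. s - x) ` S = {t. x + t \<in> S}" by (force simp: image_iff)
  have "((\<lambda>s. s - x) has_real_derivative 1) (at x within S)"
    by (auto intro!: derivative_eq_intros)
  from DERIV_image_chain[OF _ this, where f = "\<lambda>t. f (x + t)"] assms show ?thesis
    by (simp add: im o_def)
qed

text \<open>Adjoins one real coordinate: a partial derivative at the point in that coordinate and a
  continuous one in the others give a total derivative. The set \<open>X\<close> admits the
  one-sided derivatives in \<open>x\<close> at the edges of the strip.\<close>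

lemma has_derivative_real_prod:
  fixes F :: "real \<times> 'a::real_normed_vector \<Rightarrow> real"
  assumes x: "((\<lambda>x. F (x, y)) has_real_derivative d) (at x within X)"
    and y: "\<And>x y. x \<in> X \<Longrightarrow> ((\<lambda>y. F (x, y)) has_derivative blinfun_apply (D x y)) (at y)"
    and D: "continuous_on (X \<times> UNIV) (\<lambda>(x, y). D x y)" and "x \<in> X"
  shows "(F has_derivative (\<lambda>(s, h). s * d + D x y h)) (at (x, y) within X \<times> UNIV)"
proof -
  have "((\<lambda>(x, y). F (x, y)) has_derivative (\<lambda>(s, h). d * s + D x y h)) (at (x, y) within X \<times> UNIV)"
    using assms
    by (intro has_derivative_partialsI) (auto simp: continuous_on_eq_continuous_within has_field_derivative_def)
  then show ?thesis by (simp add: mult.commute)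
qed

text \<open>The gradient in \<open>(y, u, v)\<close> only, because \<open>x\<close> is never varied.
  The encoding as a bounded linear function lets its continuous dependence on the point be stated,
  as the rules for total derivatives and for differentiation under the integral require.\<close>

definition vgrad :: "real \<Rightarrow> real \<Rightarrow> (point \<Rightarrow> real) \<Rightarrow> point \<Rightarrow> (real \<times> real \<times> real) \<Rightarrow>\<^sub>L real" where
  "vgrad a b F p = partial (strip a b) dir_y F p *\<^sub>R fst_blinfun +
     partial (strip a b) dir_u F p *\<^sub>R (fst_blinfun o\<^sub>L snd_blinfun) +
     partial (strip a b) dir_v F p *\<^sub>R (snd_blinfun o\<^sub>L snd_blinfun)"

lemma vgrad_apply:
  "blinfun_apply (vgrad a b F p) (h, k, m) =
    h * partial (strip a b) dir_y F p + k * partial (strip a b) dir_u F p + m * partial (strip a b) dir_v F p"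
  by (simp add: vgrad_def blinfun.add_left blinfun.scaleR_left)

lemma dir_Basis: "(1, 0, 0, 0) \<in> (Basis :: point set)" "dir_y \<in> Basis" "dir_u \<in> Basis" "dir_v \<in> Basis"
  by (auto simp: Basis_prod_def zero_prod_def)

lemma C1_on_strip_partials:
  assumes F: "C1_on (strip a b) F" and x: "x \<in> {a..b}"
  shows "((\<lambda>x. F (x, y, u, v)) has_real_derivative partial (strip a b) (1, 0, 0, 0) F (x, y, u, v)) (at x within {a..b})"
    and "((\<lambda>y. F (x, y, u, v)) has_real_derivative partial (strip a b) dir_y F (x, y, u, v)) (at y)"
    and "((\<lambda>u. F (x, y, u, v)) has_real_derivative partial (strip a b) dir_u F (x, y, u, v)) (at u)"
    and "((\<lambda>v. F (x, y, u, v)) has_real_derivative partial (strip a b) dir_v F (x, y, u, v)) (at v)"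
  using C1_on_partial_derivative[OF F dir_Basis(1), of "(x, y, u, v)"] C1_on_partial_derivative[OF F dir_Basis(2), of "(x, y, u, v)"]
    C1_on_partial_derivative[OF F dir_Basis(3), of "(x, y, u, v)"] C1_on_partial_derivative[OF F dir_Basis(4), of "(x, y, u, v)"] x
  by (auto intro!: real_derivative_translate[where S = "{a..b}"] real_derivative_translate[where S = UNIV])

lemma C1_on_strip_continuous_partials:
  assumes "C1_on (strip a b) F"
  shows "continuous_on (strip a b) (partial (strip a b) dir_y F)"
    and "continuous_on (strip a b) (partial (strip a b) dir_u F)"
    and "continuous_on (strip a b) (partial (strip a b) dir_v F)"
  using assms dir_Basis by (auto simp: C1_on_def)

lemma continuous_on_vgrad:
  assumes "C1_on (strip a b) F"
  shows "continuous_on (strip a b) (vgrad a b F)"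
  unfolding vgrad_def[abs_def]
  by (intro continuous_on_add continuous_on_scaleR continuous_on_const C1_on_strip_continuous_partials[OF assms])

text \<open>Coordinates are adjoined from the inside outwards: first \<open>v\<close>, then
  \<open>u\<close>, then \<open>y\<close>.\<close>

lemma C1_on_strip_derivative:
  assumes F: "C1_on (strip a b) F" and x: "x \<in> {a..b}"
  shows "((\<lambda>q. F (x, q)) has_derivative vgrad a b F (x, q)) (at q)"
proof -
  note c = C1_on_strip_continuous_partials[OF F] and d = C1_on_strip_partials[OF F x]
  obtain y u v where q: "q = (y, u, v)" by (cases q)
  have 3: "((\<lambda>v. F (x, y, u, v)) has_derivative blinfun_apply (partial (strip a b) dir_v F (x, y, u, v) *\<^sub>R id_blinfun)) (at v)" for y u v
    using d(4) by (simp add: has_field_derivative_def blinfun.scaleR_left[abs_def])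
  have 2: "((\<lambda>w. F (x, y, w)) has_derivative blinfun_apply (partial (strip a b) dir_u F (x, y, w) *\<^sub>R fst_blinfun +
      partial (strip a b) dir_v F (x, y, w) *\<^sub>R snd_blinfun)) (at w)" for y w
  proof -
    obtain u v where w: "w = (u, v)" by (cases w)
    have "((\<lambda>w. F (x, y, w)) has_derivative (\<lambda>(s, h). s * partial (strip a b) dir_u F (x, y, u, v) +
        (partial (strip a b) dir_v F (x, y, u, v) *\<^sub>R id_blinfun) h)) (at (u, v) within UNIV \<times> UNIV)"
    proof (rule has_derivative_real_prod[where D = "\<lambda>u v. partial (strip a b) dir_v F (x, y, u, v) *\<^sub>R id_blinfun"])
      show "continuous_on (UNIV \<times> UNIV) (\<lambda>(u, v). partial (strip a b) dir_v F (x, y, u, v) *\<^sub>R (id_blinfun :: real \<Rightarrow>\<^sub>L real))"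
        unfolding split_beta using x by (intro continuous_intros continuous_on_compose2[OF c(3)]) auto
    qed (use d(3) 3 in auto)
    moreover have "blinfun_apply (partial (strip a b) dir_u F (x, y, w) *\<^sub>R fst_blinfun +
        partial (strip a b) dir_v F (x, y, w) *\<^sub>R snd_blinfun) =
      (\<lambda>(s, h). s * partial (strip a b) dir_u F (x, y, u, v) +
        (partial (strip a b) dir_v F (x, y, u, v) *\<^sub>R id_blinfun) h)"
      by (auto simp: w blinfun.add_left blinfun.scaleR_left)
    ultimately show ?thesis using w by simp
  qed
  have "((\<lambda>q. F (x, q)) has_derivative (\<lambda>(s, h). s * partial (strip a b) dir_y F (x, y, u, v) +
      (partial (strip a b) dir_u F (x, y, u, v) *\<^sub>R fst_blinfun +
        partial (strip a b) dir_v F (x, y, u, v) *\<^sub>R snd_blinfun) h)) (at (y, u, v) within UNIV \<times> UNIV)"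
  proof (rule has_derivative_real_prod[where D = "\<lambda>y w. partial (strip a b) dir_u F (x, y, w) *\<^sub>R fst_blinfun +
        partial (strip a b) dir_v F (x, y, w) *\<^sub>R snd_blinfun"])
    show "continuous_on (UNIV \<times> UNIV) (\<lambda>(y, w). partial (strip a b) dir_u F (x, y, w) *\<^sub>R (fst_blinfun :: (real \<times> real) \<Rightarrow>\<^sub>L real) +
        partial (strip a b) dir_v F (x, y, w) *\<^sub>R snd_blinfun)"
      unfolding split_beta using x
      by (intro continuous_intros continuous_on_compose2[OF c(2)] continuous_on_compose2[OF c(3)]) auto
  qed (use d(2) 2 in auto)
  moreover have "blinfun_apply (vgrad a b F (x, q)) = (\<lambda>(s, h). s * partial (strip a b) dir_y F (x, y, u, v) +
      (partial (strip a b) dir_u F (x, y, u, v) *\<^sub>R fst_blinfun +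
        partial (strip a b) dir_v F (x, y, u, v) *\<^sub>R snd_blinfun) h)"
    by (auto simp: q vgrad_apply blinfun.add_left blinfun.scaleR_left)
  ultimately show ?thesis using q by simp
qed

text \<open>\<open>C1_on\<close> speaks of the partial derivatives only. Continuity of
  \<open>F\<close> itself follows because continuous partial derivatives make it totally
  differentiable, within the strip, at every point.\<close>

lemma C1_on_strip_continuous:
  assumes F: "C1_on (strip a b) F"
  shows "continuous_on (strip a b) F"
proof -
  have d: "(F has_derivative (\<lambda>(s, h). s * partial (strip a b) (1, 0, 0, 0) F (x, q) + vgrad a b F (x, q) h))
      (at (x, q) within {a..b} \<times> UNIV)" if x: "x \<in> {a..b}" for x q
    using C1_on_strip_partials(1)[OF F x] C1_on_strip_derivative[OF F] continuous_on_vgrad[OF F] x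
    by (intro has_derivative_real_prod[where D = "\<lambda>x q. vgrad a b F (x, q)"]) (cases q, auto simp: split_beta)
  show ?thesis
    unfolding continuous_on_eq_continuous_within
  proof (intro ballI)
    fix p assume "p \<in> strip a b"
    then show "continuous (at p within strip a b) F"
      using has_derivative_continuous[OF d[of "fst p" "snd p"]] by auto
  qed
qed

lemma not_depends_on_strip:
  assumes "\<not> depends_on (strip a b) (0, e) F" "x \<in> {a..b}"
  shows "F (x, q + t *\<^sub>R e) = F (x, q)"
proof -
  have "(x, q) \<in> strip a b" "(x, q) + t *\<^sub>R (0, e) \<in> strip a b"
    using assms(2) by auto
  then have "F ((x, q) + t *\<^sub>R (0, e)) = F (x, q)"
    using assms(1) unfolding depends_on_def by metis
  then show ?thesis by simp
qed

text \<open>A shift in the direction \<open>e\<close> commutes with moving in the direction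
  \<open>e'\<close>, so the two functions of one variable that are differentiated are equal.\<close>

lemma not_depends_on_strip_partial:
  assumes "\<not> depends_on (strip a b) (0, e) F" "x \<in> {a..b}"
  shows "partial (strip a b) (0, e') F (x, q + t *\<^sub>R e) = partial (strip a b) (0, e') F (x, q)"
proof -
  have "F (x, q + t *\<^sub>R e + s *\<^sub>R e') = F (x, q + s *\<^sub>R e')" for s
    using not_depends_on_strip[OF assms, of "q + s *\<^sub>R e'" t] by (simp add: algebra_simps)
  then show ?thesis using assms(2) by (simp add: partial_def)
qed

lemma not_depends_on_strip_partial_zero:
  assumes "\<not> depends_on (strip a b) (0, e) F" "x \<in> {a..b}"
  shows "partial (strip a b) (0, e) F (x, q) = 0"
proof -
  have "(\<lambda>t. F ((x, q) + t *\<^sub>R (0, e))) = (\<lambda>t. F (x, q))"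
    using not_depends_on_strip[OF assms] by auto
  then show ?thesis using assms(2) by (simp add: partial_def)
qed

subsection \<open>Riemann-Liouville derivatives\<close>

lemma Gamma_one_minus_pos: "\<gamma> < 1 \<Longrightarrow> 0 < Gamma (1 - \<gamma> :: real)"
  by (intro Gamma_real_pos) simp

lemma left_RL_formula_eq:
  assumes "\<gamma> < 1" "c < d" "x \<in> {c..d}"
    and D: "(frac_left \<gamma> c f has_real_derivative Gamma (1 - \<gamma>) * D) (at x within {c..d})"
  shows "left_RL_exists \<gamma> c d f x" "left_RL_formula \<gamma> c d f x = D"
proof -
  have "(frac_left \<gamma> c f has_vector_derivative Gamma (1 - \<gamma>) * D) (at x within {c..d})"
    using D by (simp add: has_real_derivative_iff_has_vector_derivative)
  then have "vector_derivative (frac_left \<gamma> c f) (at x within {c..d}) = Gamma (1 - \<gamma>) * D"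
    using assms by (intro vector_derivative_within_closed_interval) auto
  then show "left_RL_formula \<gamma> c d f x = D"
    using Gamma_one_minus_pos[OF assms(1)] by (simp add: left_RL_formula_def frac_left_def[abs_def])
  show "left_RL_exists \<gamma> c d f x"
    using D by (auto simp: left_RL_exists_def frac_left_def[abs_def] real_differentiable_def)
qed

lemma right_RL_formula_eq:
  assumes "\<gamma> < 1" "c < d" "x \<in> {c..d}"
    and D: "(frac_right \<gamma> d f has_real_derivative - (Gamma (1 - \<gamma>) * D)) (at x within {c..d})"
  shows "right_RL_exists \<gamma> c d f x" "right_RL_formula \<gamma> c d f x = D"
proof -
  have "(frac_right \<gamma> d f has_vector_derivative - (Gamma (1 - \<gamma>) * D)) (at x within {c..d})"
    using D by (simp add: has_real_derivative_iff_has_vector_derivative)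
  then have "vector_derivative (frac_right \<gamma> d f) (at x within {c..d}) = - (Gamma (1 - \<gamma>) * D)"
    using assms by (intro vector_derivative_within_closed_interval) auto
  then show "right_RL_formula \<gamma> c d f x = D"
    using Gamma_one_minus_pos[OF assms(1)] by (simp add: right_RL_formula_def frac_right_def[abs_def])
  show "right_RL_exists \<gamma> c d f x"
    using D by (auto simp: right_RL_exists_def frac_right_def[abs_def] real_differentiable_def)
qed

text \<open>At the base point the derivative is defined as a limit, and continuity of the candidate
  \<open>D\<close> up to that point identifies the limit as \<open>D c\<close>. Continuity of left
  derivatives on closed intervals is always established through such a candidate.\<close>

lemma left_RL_eqI:
  assumes "\<gamma> < 1" "c < d" and D: "continuous_on {c..d} D"
    and der: "\<And>x. x \<in> {c<..d} \<Longrightarrow> (frac_left \<gamma> c f has_real_derivative Gamma (1 - \<gamma>) * D x) (at x within {c..d})"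
  shows "continuous_left_RL \<gamma> c d f" and "\<And>x. x \<in> {c..d} \<Longrightarrow> left_RL \<gamma> c d f x = D x"
proof -
  have eq: "left_RL_formula \<gamma> c d f x = D x" if "x \<in> {c<..d}" for x
    using left_RL_formula_eq[OF assms(1,2) _ der[OF that]] that by auto
  have "(D \<longlongrightarrow> D c) (at_right c)"
    using D \<open>c < d\<close> by (auto simp: continuous_on_Icc_at_rightD)
  then have "(left_RL_formula \<gamma> c d f \<longlongrightarrow> D c) (at_right c)"
    using eq \<open>c < d\<close>
    by (elim Lim_transform_eventually) (auto simp: eventually_at_right_field intro!: exI[of _ d])
  then have "Lim (at_right c) (left_RL_formula \<gamma> c d f) = D c"
    by (intro tendsto_Lim) auto
  then show *: "left_RL \<gamma> c d f x = D x" if "x \<in> {c..d}" for x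
    using eq that by (auto simp: left_RL_def)
  have "continuous_on {c..d} (left_RL \<gamma> c d f)"
    by (rule continuous_on_eq[OF D]) (simp add: *)
  moreover have "left_RL_exists \<gamma> c d f x" if "x \<in> {c<..d}" for x
    using left_RL_formula_eq[OF assms(1,2) _ der[OF that]] that by auto
  ultimately show "continuous_left_RL \<gamma> c d f"
    by (auto simp: continuous_left_RL_def)
qed

lemma right_RL_eqI:
  assumes "\<gamma> < 1" "c < d" and D: "continuous_on {c..d} D"
    and der: "\<And>x. x \<in> {c..<d} \<Longrightarrow> (frac_right \<gamma> d f has_real_derivative - (Gamma (1 - \<gamma>) * D x)) (at x within {c..d})"
  shows "continuous_right_RL \<gamma> c d f" and "\<And>x. x \<in> {c..d} \<Longrightarrow> right_RL \<gamma> c d f x = D x"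
proof -
  have eq: "right_RL_formula \<gamma> c d f x = D x" if "x \<in> {c..<d}" for x
    using right_RL_formula_eq[OF assms(1,2) _ der[OF that]] that by auto
  have "(D \<longlongrightarrow> D d) (at_left d)"
    using D \<open>c < d\<close> by (auto simp: continuous_on_Icc_at_leftD)
  then have "(right_RL_formula \<gamma> c d f \<longlongrightarrow> D d) (at_left d)"
    using eq \<open>c < d\<close>
    by (elim Lim_transform_eventually) (auto simp: eventually_at_left_field intro!: exI[of _ c])
  then have "Lim (at_left d) (right_RL_formula \<gamma> c d f) = D d"
    by (intro tendsto_Lim) auto
  then show *: "right_RL \<gamma> c d f x = D x" if "x \<in> {c..d}" for x
    using eq that by (auto simp: right_RL_def)
  have "continuous_on {c..d} (right_RL \<gamma> c d f)"
    by (rule continuous_on_eq[OF D]) (simp add: *)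
  moreover have "right_RL_exists \<gamma> c d f x" if "x \<in> {c..<d}" for x
    using right_RL_formula_eq[OF assms(1,2) _ der[OF that]] that by auto
  ultimately show "continuous_right_RL \<gamma> c d f"
    by (auto simp: continuous_right_RL_def)
qed

lemma continuous_left_RL_derivative:
  assumes "\<gamma> < 1" "c < d" "continuous_left_RL \<gamma> c d f" "x \<in> {c<..d}"
  shows "(frac_left \<gamma> c f has_real_derivative Gamma (1 - \<gamma>) * left_RL \<gamma> c d f x) (at x within {c..d})"
proof -
  obtain D where D: "(frac_left \<gamma> c f has_real_derivative D) (at x within {c..d})"
    using assms(3,4) unfolding continuous_left_RL_def left_RL_exists_def frac_left_def[abs_def] real_differentiable_def
    by blast
  moreover have "left_RL \<gamma> c d f x = D / Gamma (1 - \<gamma>)"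
    using left_RL_formula_eq(2)[of \<gamma> c d x f "D / Gamma (1 - \<gamma>)"] D assms Gamma_one_minus_pos[OF assms(1)]
    by (auto simp: left_RL_def)
  ultimately show ?thesis
    using Gamma_one_minus_pos[OF assms(1)] by simp
qed

lemma continuous_right_RL_derivative:
  assumes "\<gamma> < 1" "c < d" "continuous_right_RL \<gamma> c d f" "x \<in> {c..<d}"
  shows "(frac_right \<gamma> d f has_real_derivative - (Gamma (1 - \<gamma>) * right_RL \<gamma> c d f x)) (at x within {c..d})"
proof -
  obtain D where D: "(frac_right \<gamma> d f has_real_derivative D) (at x within {c..d})"
    using assms(3,4) unfolding continuous_right_RL_def right_RL_exists_def frac_right_def[abs_def] real_differentiable_def
    by blast
  moreover have "right_RL \<gamma> c d f x = - D / Gamma (1 - \<gamma>)"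
    using right_RL_formula_eq(2)[of \<gamma> c d x f "- D / Gamma (1 - \<gamma>)"] D assms Gamma_one_minus_pos[OF assms(1)]
    by (auto simp: right_RL_def)
  ultimately show ?thesis
    using Gamma_one_minus_pos[OF assms(1)] by simp
qed

lemma left_RL_linear:
  assumes "0 < \<gamma>" "\<gamma> < 1" "c < d" and f: "continuous_on {c..d} f" "continuous_left_RL \<gamma> c d f"
    and g: "continuous_on {c..d} g" "continuous_left_RL \<gamma> c d g"
  shows "continuous_left_RL \<gamma> c d (\<lambda>t. p * f t + q * g t)"
    and "\<And>x. x \<in> {c..d} \<Longrightarrow> left_RL \<gamma> c d (\<lambda>t. p * f t + q * g t) x = p * left_RL \<gamma> c d f x + q * left_RL \<gamma> c d g x"
proof -
  have D: "continuous_on {c..d} (\<lambda>x. p * left_RL \<gamma> c d f x + q * left_RL \<gamma> c d g x)"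
    using f g by (auto simp: continuous_left_RL_def intro!: continuous_intros)
  have der: "(frac_left \<gamma> c (\<lambda>t. p * f t + q * g t) has_real_derivative
      Gamma (1 - \<gamma>) * (p * left_RL \<gamma> c d f x + q * left_RL \<gamma> c d g x)) (at x within {c..d})"
    if x: "x \<in> {c<..d}" for x
  proof (rule has_field_derivative_transform_within[where d = 1 and f = "\<lambda>x. p * frac_left \<gamma> c f x + q * frac_left \<gamma> c g x"])
    show "((\<lambda>x. p * frac_left \<gamma> c f x + q * frac_left \<gamma> c g x) has_real_derivative
        Gamma (1 - \<gamma>) * (p * left_RL \<gamma> c d f x + q * left_RL \<gamma> c d g x)) (at x within {c..d})"
      using continuous_left_RL_derivative[OF assms(2,3) f(2) x] continuous_left_RL_derivative[OF assms(2,3) g(2) x]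
      by (auto intro!: derivative_eq_intros simp: algebra_simps)
    show "p * frac_left \<gamma> c f s + q * frac_left \<gamma> c g s = frac_left \<gamma> c (\<lambda>t. p * f t + q * g t) s"
      if "s \<in> {c..d}" for s
      using that assms by (intro frac_left_linear[symmetric] continuous_on_subset[OF f(1)] continuous_on_subset[OF g(1)]) auto
  qed (use x in auto)
  show "continuous_left_RL \<gamma> c d (\<lambda>t. p * f t + q * g t)"
    and "\<And>x. x \<in> {c..d} \<Longrightarrow> left_RL \<gamma> c d (\<lambda>t. p * f t + q * g t) x = p * left_RL \<gamma> c d f x + q * left_RL \<gamma> c d g x"
    using left_RL_eqI[OF assms(2,3) D der] by auto
qed

lemma right_RL_linear:
  assumes "0 < \<gamma>" "\<gamma> < 1" "c < d" and f: "continuous_on {c..d} f" "continuous_right_RL \<gamma> c d f"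
    and g: "continuous_on {c..d} g" "continuous_right_RL \<gamma> c d g"
  shows "continuous_right_RL \<gamma> c d (\<lambda>t. p * f t + q * g t)"
    and "\<And>x. x \<in> {c..d} \<Longrightarrow> right_RL \<gamma> c d (\<lambda>t. p * f t + q * g t) x = p * right_RL \<gamma> c d f x + q * right_RL \<gamma> c d g x"
proof -
  have D: "continuous_on {c..d} (\<lambda>x. p * right_RL \<gamma> c d f x + q * right_RL \<gamma> c d g x)"
    using f g by (auto simp: continuous_right_RL_def intro!: continuous_intros)
  have der: "(frac_right \<gamma> d (\<lambda>t. p * f t + q * g t) has_real_derivative
      - (Gamma (1 - \<gamma>) * (p * right_RL \<gamma> c d f x + q * right_RL \<gamma> c d g x))) (at x within {c..d})"
    if x: "x \<in> {c..<d}" for x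
  proof (rule has_field_derivative_transform_within[where d = 1 and f = "\<lambda>x. p * frac_right \<gamma> d f x + q * frac_right \<gamma> d g x"])
    show "((\<lambda>x. p * frac_right \<gamma> d f x + q * frac_right \<gamma> d g x) has_real_derivative
        - (Gamma (1 - \<gamma>) * (p * right_RL \<gamma> c d f x + q * right_RL \<gamma> c d g x))) (at x within {c..d})"
      using continuous_right_RL_derivative[OF assms(2,3) f(2) x] continuous_right_RL_derivative[OF assms(2,3) g(2) x]
      by (auto intro!: derivative_eq_intros simp: algebra_simps)
    show "p * frac_right \<gamma> d f s + q * frac_right \<gamma> d g s = frac_right \<gamma> d (\<lambda>t. p * f t + q * g t) s"
      if "s \<in> {c..d}" for s
      using that assms by (intro frac_right_linear[symmetric] continuous_on_subset[OF f(1)] continuous_on_subset[OF g(1)]) auto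
  qed (use x in auto)
  show "continuous_right_RL \<gamma> c d (\<lambda>t. p * f t + q * g t)"
    and "\<And>x. x \<in> {c..d} \<Longrightarrow> right_RL \<gamma> c d (\<lambda>t. p * f t + q * g t) x = p * right_RL \<gamma> c d f x + q * right_RL \<gamma> c d g x"
    using right_RL_eqI[OF assms(2,3) D der] by auto
qed

text \<open>A bump and its derivative are 0 at \<open>a\<close> and to its left, even if
  \<open>p = a\<close>. Hence the outer derivative moves onto the bump, and the result is continuous
  up to \<open>a\<close>.\<close>

lemma left_RL_bump:
  assumes "0 < \<gamma>" "\<gamma> < 1" "a \<le> p" "p < q" "q \<le> b"
  shows "continuous_left_RL \<gamma> a b (bump p q)"
    and "\<And>x. x \<in> {a..b} \<Longrightarrow> left_RL \<gamma> a b (bump p q) x = frac_left \<gamma> a (bump_deriv p q) x / Gamma (1 - \<gamma>)"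
proof -
  note G = Gamma_one_minus_pos[OF assms(2)]
  have cancel: "Gamma (1 - \<gamma>) * (z / Gamma (1 - \<gamma>)) = z" for z
    using nonzero_mult_div_cancel_left[OF G[THEN less_imp_neq, symmetric]] by simp
  have out: "bump p q t = 0" "bump_deriv p q t = 0" if "t \<le> a" for t
    using assms that by (auto intro!: bump_outside)
  have D: "continuous_on {a..b} (\<lambda>x. frac_left \<gamma> a (bump_deriv p q) x / Gamma (1 - \<gamma>))"
    using assms(1-5)
    by (intro continuous_on_divide continuous_on_const frac_left_vanishing_continuous continuous_on_bump_deriv out ballI G[THEN less_imp_neq, symmetric])
  have der: "(frac_left \<gamma> a (bump p q) has_real_derivative
      Gamma (1 - \<gamma>) * (frac_left \<gamma> a (bump_deriv p q) x / Gamma (1 - \<gamma>))) (at x within {a..b})"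
    if "x \<in> {a<..b}" for x
    unfolding cancel using assms that
      frac_left_vanishing_derivative[of \<gamma> x a b "bump p q" "bump_deriv p q", OF _ _ _ bump_derivative continuous_on_bump_deriv out]
    by auto
  have "a < b" using assms by simp
  from left_RL_eqI[OF assms(2) this D der] show "continuous_left_RL \<gamma> a b (bump p q)"
    and "\<And>x. x \<in> {a..b} \<Longrightarrow> left_RL \<gamma> a b (bump p q) x = frac_left \<gamma> a (bump_deriv p q) x / Gamma (1 - \<gamma>)"
    by auto
qed

lemma right_RL_bump:
  assumes "0 < \<gamma>" "\<gamma> < 1" "a \<le> p" "p < q" "q \<le> b"
  shows "continuous_right_RL \<gamma> a b (bump p q)"
    and "\<And>x. x \<in> {a..b} \<Longrightarrow> right_RL \<gamma> a b (bump p q) x = - frac_right \<gamma> b (bump_deriv p q) x / Gamma (1 - \<gamma>)"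
proof -
  note G = Gamma_one_minus_pos[OF assms(2)]
  have cancel: "Gamma (1 - \<gamma>) * (z / Gamma (1 - \<gamma>)) = z" for z
    using nonzero_mult_div_cancel_left[OF G[THEN less_imp_neq, symmetric]] by simp
  have out: "bump p q t = 0" "bump_deriv p q t = 0" if "b \<le> t" for t
    using assms that by (auto intro!: bump_outside)
  have D: "continuous_on {a..b} (\<lambda>x. - frac_right \<gamma> b (bump_deriv p q) x / Gamma (1 - \<gamma>))"
    using assms(1-5)
    by (intro continuous_on_divide continuous_on_minus continuous_on_const frac_right_vanishing_continuous continuous_on_bump_deriv out ballI G[THEN less_imp_neq, symmetric])
  have der: "(frac_right \<gamma> b (bump p q) has_real_derivative
      - (Gamma (1 - \<gamma>) * (- frac_right \<gamma> b (bump_deriv p q) x / Gamma (1 - \<gamma>)))) (at x within {a..b})"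
    if "x \<in> {a..<b}" for x
    unfolding minus_divide_left[symmetric] mult_minus_right minus_minus cancel using assms that
      frac_right_vanishing_derivative[of \<gamma> x a b "bump p q" "bump_deriv p q", OF _ _ _ bump_derivative continuous_on_bump_deriv out]
    by auto
  have "a < b" using assms by simp
  from right_RL_eqI[OF assms(2) this D der] show "continuous_right_RL \<gamma> a b (bump p q)"
    and "\<And>x. x \<in> {a..b} \<Longrightarrow> right_RL \<gamma> a b (bump p q) x = - frac_right \<gamma> b (bump_deriv p q) x / Gamma (1 - \<gamma>)"
    by auto
qed

text \<open>The open interval is essential: if \<open>c > a\<close> and
  \<open>f c \<noteq> 0\<close>, the derivative based at \<open>c\<close> grows like
  \<open>(x - c) powr (- \<gamma>)\<close> near \<open>c\<close>. Inside, it differs from the one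
  based at \<open>a\<close> by a continuous function.\<close>

lemma left_RL_truncated:
  assumes "0 < \<gamma>" "\<gamma> < 1" "a \<le> c" "c < d" "d \<le> b" and f: "continuous_on {a..b} f" "continuous_left_RL \<gamma> a b f"
  shows "\<And>x. x \<in> {c<..<d} \<Longrightarrow> left_RL_exists \<gamma> c d f x"
    and "\<And>x. x \<in> {c<..<d} \<Longrightarrow> (frac_left \<gamma> c f has_real_derivative Gamma (1 - \<gamma>) * left_RL \<gamma> c d f x) (at x)"
    and "continuous_on {c<..<d} (left_RL \<gamma> c d f)"
proof -
  note G = Gamma_one_minus_pos[OF assms(2), THEN less_imp_neq, symmetric]
  have "continuous_on {a..d} f"
    using f(1) by (rule continuous_on_subset) (use assms in auto)
  from frac_left_truncate[OF assms(1-4) this] obtain R where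
    R: "continuous_on {c<..<d} R" and
    dR: "\<And>s. s \<in> {c<..<d} \<Longrightarrow> ((\<lambda>s. frac_left \<gamma> a f s - frac_left \<gamma> c f s) has_real_derivative R s) (at s)"
    by blast
  let ?D = "\<lambda>x. left_RL \<gamma> a b f x - R x / Gamma (1 - \<gamma>)"
  have der: "(frac_left \<gamma> c f has_real_derivative Gamma (1 - \<gamma>) * ?D x) (at x)" if x: "x \<in> {c<..<d}" for x
  proof -
    have "(frac_left \<gamma> a f has_real_derivative Gamma (1 - \<gamma>) * left_RL \<gamma> a b f x) (at x within {a..b})"
      using x assms by (intro continuous_left_RL_derivative) auto
    then have "(frac_left \<gamma> a f has_real_derivative Gamma (1 - \<gamma>) * left_RL \<gamma> a b f x) (at x)"
      using x assms by (subst (asm) at_within_Icc_at) auto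
    from DERIV_diff[OF this dR[OF x]] show ?thesis
      using G by (simp add: right_diff_distrib)
  qed
  have exeq: "left_RL_exists \<gamma> c d f x \<and> left_RL \<gamma> c d f x = ?D x" if x: "x \<in> {c<..<d}" for x
    using left_RL_formula_eq[OF assms(2,4) _ has_field_derivative_at_within[OF der[OF x]]] x
    by (auto simp: left_RL_def)
  then show "left_RL_exists \<gamma> c d f x" if "x \<in> {c<..<d}" for x using that by blast
  show "(frac_left \<gamma> c f has_real_derivative Gamma (1 - \<gamma>) * left_RL \<gamma> c d f x) (at x)" if "x \<in> {c<..<d}" for x
    using der[OF that] exeq[OF that] by simp
  have "continuous_on {c<..<d} (left_RL \<gamma> a b f)"
    using f(2) assms(3,5) unfolding continuous_left_RL_def by (auto elim!: continuous_on_subset)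
  then have "continuous_on {c<..<d} ?D"
    using G by (intro continuous_on_diff continuous_on_divide continuous_on_const R) auto
  then show "continuous_on {c<..<d} (left_RL \<gamma> c d f)"
    by (rule continuous_on_eq) (use exeq in auto)
qed

lemma right_RL_truncated:
  assumes "0 < \<gamma>" "\<gamma> < 1" "a \<le> c" "c < d" "d \<le> b" and f: "continuous_on {a..b} f" "continuous_right_RL \<gamma> a b f"
  shows "\<And>x. x \<in> {c<..<d} \<Longrightarrow> right_RL_exists \<gamma> c d f x"
    and "\<And>x. x \<in> {c<..<d} \<Longrightarrow> (frac_right \<gamma> d f has_real_derivative - (Gamma (1 - \<gamma>) * right_RL \<gamma> c d f x)) (at x)"
    and "continuous_on {c<..<d} (right_RL \<gamma> c d f)"
proof -
  note G = Gamma_one_minus_pos[OF assms(2), THEN less_imp_neq, symmetric]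
  have "continuous_on {c..b} f"
    using f(1) by (rule continuous_on_subset) (use assms in auto)
  from frac_right_truncate[OF assms(1,2,5,4) this] obtain R where
    R: "continuous_on {c<..<d} R" and
    dR: "\<And>s. s \<in> {c<..<d} \<Longrightarrow> ((\<lambda>s. frac_right \<gamma> b f s - frac_right \<gamma> d f s) has_real_derivative R s) (at s)"
    by blast
  let ?D = "\<lambda>x. right_RL \<gamma> a b f x + R x / Gamma (1 - \<gamma>)"
  have der: "(frac_right \<gamma> d f has_real_derivative - (Gamma (1 - \<gamma>) * ?D x)) (at x)" if x: "x \<in> {c<..<d}" for x
  proof -
    have "(frac_right \<gamma> b f has_real_derivative - (Gamma (1 - \<gamma>) * right_RL \<gamma> a b f x)) (at x within {a..b})"
      using x assms by (intro continuous_right_RL_derivative) auto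
    then have "(frac_right \<gamma> b f has_real_derivative - (Gamma (1 - \<gamma>) * right_RL \<gamma> a b f x)) (at x)"
      using x assms by (subst (asm) at_within_Icc_at) auto
    from DERIV_diff[OF this dR[OF x]] show ?thesis
      using G by (simp add: distrib_left)
  qed
  have exeq: "right_RL_exists \<gamma> c d f x \<and> right_RL \<gamma> c d f x = ?D x" if x: "x \<in> {c<..<d}" for x
    using right_RL_formula_eq[OF assms(2,4) _ has_field_derivative_at_within[OF der[OF x]]] x
    by (auto simp: right_RL_def)
  then show "right_RL_exists \<gamma> c d f x" if "x \<in> {c<..<d}" for x using that by blast
  show "(frac_right \<gamma> d f has_real_derivative - (Gamma (1 - \<gamma>) * right_RL \<gamma> c d f x)) (at x)" if "x \<in> {c<..<d}" for x
    using der[OF that] exeq[OF that] by simp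
  have "continuous_on {c<..<d} (right_RL \<gamma> a b f)"
    using f(2) assms(3,5) unfolding continuous_right_RL_def by (auto elim!: continuous_on_subset)
  then have "continuous_on {c<..<d} ?D"
    using G by (intro continuous_on_add continuous_on_divide continuous_on_const R) auto
  then show "continuous_on {c<..<d} (right_RL \<gamma> c d f)"
    by (rule continuous_on_eq) (use exeq in auto)
qed

section \<open>From the first variation to the three equations\<close>

lemma vanishes_onI:
  assumes "\<And>x. x \<in> {c<..<d} \<Longrightarrow> E x = 0"
  shows "vanishes_on c d E"
proof -
  have "(E \<longlongrightarrow> 0) (at_right c)" if "c < d"
    by (rule Lim_transform_eventually[OF tendsto_const])
      (use that assms in \<open>auto simp: eventually_at_right_field intro!: exI[of _ d]\<close>)
  moreover have "(E \<longlongrightarrow> 0) (at_left d)" if "c < d"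
    by (rule Lim_transform_eventually[OF tendsto_const])
      (use that assms in \<open>auto simp: eventually_at_left_field intro!: exI[of _ c]\<close>)
  ultimately show ?thesis using assms by (simp add: vanishes_on_def)
qed

text \<open>Bumps range over all of \<open>[a,b]\<close>: even one supported off
  \<open>[A,B]\<close> can change the integrand on \<open>[A,B]\<close>, because fractional
  derivatives are nonlocal. Such bumps are the source of the second and third equations.\<close>

lemma euler_lagrange_of_variation:
  fixes Ky Ku Kv :: "real \<Rightarrow> real"
  assumes ab: "a \<le> A" "A < B" "B \<le> b" and \<alpha>: "0 < \<alpha>" "\<alpha> < 1" and \<beta>: "0 < \<beta>" "\<beta> < 1"
    and Ky: "continuous_on {a..b} Ky"
    and Ku: "continuous_on {a..b} Ku" "continuous_right_RL \<alpha> a b Ku"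
    and Kv: "continuous_on {a..b} Kv" "continuous_left_RL \<beta> a b Kv"
    and var: "\<And>p q. a \<le> p \<Longrightarrow> p < q \<Longrightarrow> q \<le> b \<Longrightarrow> integral {A..B} (\<lambda>x. Ky x * bump p q x +
      Ku x * left_RL \<alpha> a b (bump p q) x + Kv x * right_RL \<beta> a b (bump p q) x) = 0"
  shows "\<And>x. x \<in> {A<..<B} \<Longrightarrow> Ky x + right_RL \<alpha> A B Ku x + left_RL \<beta> A B Kv x = 0"
    and "\<And>x. x \<in> {a<..<A} \<Longrightarrow> right_RL \<alpha> a B Ku x - right_RL \<alpha> a A Ku x = 0"
    and "\<And>x. x \<in> {B<..<b} \<Longrightarrow> left_RL \<beta> A b Kv x - left_RL \<beta> B b Kv x = 0"
proof -
  \<comment> \<open>These are the coefficients that \<open>bump_deriv\<close> receives at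
    \<open>t\<close> after the exchange. \<open>P t\<close> stems from the left derivative and
    collects the part of \<open>[A,B]\<close> right of \<open>t\<close>; \<open>Q t\<close> stems
    from the right derivative and collects the part left of \<open>t\<close>.\<close>
  define P where "P t = integral {max t A..B} (\<lambda>x. (x - t) powr (- \<alpha>) * Ku x) / Gamma (1 - \<alpha>)" for t
  define Q where "Q t = integral {A..min t B} (\<lambda>x. (t - x) powr (- \<beta>) * Kv x) / Gamma (1 - \<beta>)" for t
  note G\<alpha> = Gamma_one_minus_pos[OF \<alpha>(2), THEN less_imp_neq, symmetric]
  note G\<beta> = Gamma_one_minus_pos[OF \<beta>(2), THEN less_imp_neq, symmetric]
  have AB: "{A..B} \<subseteq> {a..b}" using ab by auto
  note KAB = continuous_on_subset[OF Ky AB] continuous_on_subset[OF Ku(1) AB] continuous_on_subset[OF Kv(1) AB]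
  \<comment> \<open>The minus sign before the last integral is that of the right Riemann-Liouville
    derivative, so \<open>P - Q\<close> takes the role of \<open>\<Psi>\<close>.\<close>
  have V: "integral {A..B} (\<lambda>x. Ky x * bump p q x) + integral {p..q} (\<lambda>t. bump_deriv p q t * P t)
      - integral {p..q} (\<lambda>t. bump_deriv p q t * Q t) = 0" if pq: "a \<le> p" "p < q" "q \<le> b" for p q
  proof -
    note L = left_RL_bump[OF \<alpha> pq] and R = right_RL_bump[OF \<beta> pq]
    have out: "bump_deriv p q t = 0" if "t \<notin> {p..q}" for t
      using that pq by (intro bump_outside) auto
    have i1: "(\<lambda>x. Ky x * bump p q x) integrable_on {A..B}"
      by (intro integrable_continuous_interval continuous_on_mult KAB continuous_on_bump)
    have i2: "(\<lambda>x. Ku x * left_RL \<alpha> a b (bump p q) x) integrable_on {A..B}"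
      using L(1) AB unfolding continuous_left_RL_def
      by (intro integrable_continuous_interval continuous_on_mult KAB) (auto elim!: continuous_on_subset)
    have i3: "(\<lambda>x. Kv x * right_RL \<beta> a b (bump p q) x) integrable_on {A..B}"
      using R(1) AB unfolding continuous_right_RL_def
      by (intro integrable_continuous_interval continuous_on_mult KAB) (auto elim!: continuous_on_subset)
    have "integral {A..B} (\<lambda>x. Ku x * left_RL \<alpha> a b (bump p q) x) =
        integral {A..B} (\<lambda>x. Ku x * frac_left \<alpha> a (bump_deriv p q) x / Gamma (1 - \<alpha>))"
      using AB by (intro Henstock_Kurzweil_Integration.integral_cong) (auto simp: L(2))
    also have "\<dots> = integral {A..B} (\<lambda>x. Ku x * frac_left \<alpha> a (bump_deriv p q) x) / Gamma (1 - \<alpha>)"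
      by simp
    also have "\<dots> = integral {p..q} (\<lambda>t. bump_deriv p q t * P t)"
      unfolding P_def times_divide_eq_right using ab pq
      by (subst frac_left_swap[OF \<alpha> ab(1,3) KAB(2) continuous_on_bump_deriv out pq(1,3)]) auto
    finally have u: "integral {A..B} (\<lambda>x. Ku x * left_RL \<alpha> a b (bump p q) x) = integral {p..q} (\<lambda>t. bump_deriv p q t * P t)" .
    have "integral {A..B} (\<lambda>x. Kv x * right_RL \<beta> a b (bump p q) x) =
        integral {A..B} (\<lambda>x. - (Kv x * frac_right \<beta> b (bump_deriv p q) x / Gamma (1 - \<beta>)))"
      using AB by (intro Henstock_Kurzweil_Integration.integral_cong) (auto simp: R(2))
    also have "\<dots> = - (integral {A..B} (\<lambda>x. Kv x * frac_right \<beta> b (bump_deriv p q) x) / Gamma (1 - \<beta>))"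
      by simp
    also have "\<dots> = - integral {p..q} (\<lambda>t. bump_deriv p q t * Q t)"
      unfolding Q_def times_divide_eq_right using ab pq
      by (subst frac_right_swap[OF \<beta> ab(1,3) KAB(3) continuous_on_bump_deriv out pq(1,3)]) auto
    finally have v: "integral {A..B} (\<lambda>x. Kv x * right_RL \<beta> a b (bump p q) x) = - integral {p..q} (\<lambda>t. bump_deriv p q t * Q t)" .
    show ?thesis
      using var[OF pq] i1 i2 i3 u v
      by (simp add: Henstock_Kurzweil_Integration.integral_add integrable_add)
  qed
  show "Ky x + right_RL \<alpha> A B Ku x + left_RL \<beta> A B Kv x = 0" if x: "x \<in> {A<..<B}" for x
  proof -
    note R = right_RL_truncated[OF \<alpha> ab Ku] and L = left_RL_truncated[OF \<beta> ab Kv]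
    have PQ: "P t = frac_right \<alpha> B Ku t / Gamma (1 - \<alpha>)" "Q t = frac_left \<beta> A Kv t / Gamma (1 - \<beta>)" if "t \<in> {A<..<B}" for t
      using that by (simp_all add: P_def Q_def frac_right_def frac_left_def max_def min_def)
    \<comment> \<open>Between \<open>A\<close> and \<open>B\<close>, \<open>P\<close> and
      \<open>Q\<close> are full fractional integrals based at \<open>B\<close> and \<open>A\<close>.
      The derivative of \<open>P\<close> is minus the right derivative and that of \<open>Q\<close>
      is the left one, so \<open>\<Phi> = \<Psi>'\<close> reads as stated.\<close>
    have "Ky x = - right_RL \<alpha> A B Ku x - left_RL \<beta> A B Kv x"
    proof (rule du_bois_reymond_bump[OF _ _ _ _ x])
      show "continuous_on {A<..<B} Ky" using Ky by (rule continuous_on_subset) (use ab in auto)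
      show "continuous_on {A<..<B} (\<lambda>x. - right_RL \<alpha> A B Ku x - left_RL \<beta> A B Kv x)"
        by (intro continuous_on_diff continuous_on_minus R(3) L(3))
      show der: "((\<lambda>t. frac_right \<alpha> B Ku t / Gamma (1 - \<alpha>) - frac_left \<beta> A Kv t / Gamma (1 - \<beta>)) has_real_derivative
          - right_RL \<alpha> A B Ku t - left_RL \<beta> A B Kv t) (at t)" if "t \<in> {A<..<B}" for t
        using DERIV_diff[OF DERIV_cdivide[OF R(2)[OF that], of "Gamma (1 - \<alpha>)"] DERIV_cdivide[OF L(2)[OF that], of "Gamma (1 - \<beta>)"]] G\<alpha> G\<beta>
        by simp
      fix p q assume pq: "A < p" "p < q" "q < B"
      have sub: "{p..q} \<subseteq> {A<..<B}" using pq by auto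
      have c1: "continuous_on {p..q} (\<lambda>t. frac_right \<alpha> B Ku t / Gamma (1 - \<alpha>))"
        and c2: "continuous_on {p..q} (\<lambda>t. frac_left \<beta> A Kv t / Gamma (1 - \<beta>))"
        using R(2)[THEN DERIV_isCont] L(2)[THEN DERIV_isCont] sub G\<alpha> G\<beta>
        by (auto intro!: continuous_on_divide continuous_at_imp_continuous_on)
      have "integral {A..B} (\<lambda>x. Ky x * bump p q x) = integral {p..q} (\<lambda>x. Ky x * bump p q x)"
        unfolding Henstock_Kurzweil_Integration.integral_restrict_UNIV[of "{p..q}", symmetric]
          Henstock_Kurzweil_Integration.integral_restrict_UNIV[of "{A..B}", symmetric]
        using pq by (intro arg_cong[where f = "integral UNIV"]) (auto simp: fun_eq_iff bump_outside)
      moreover have "integral {p..q} (\<lambda>t. bump_deriv p q t * P t) = integral {p..q} (\<lambda>t. bump_deriv p q t * (frac_right \<alpha> B Ku t / Gamma (1 - \<alpha>)))"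
        and "integral {p..q} (\<lambda>t. bump_deriv p q t * Q t) = integral {p..q} (\<lambda>t. bump_deriv p q t * (frac_left \<beta> A Kv t / Gamma (1 - \<beta>)))"
        using PQ sub by (auto intro!: Henstock_Kurzweil_Integration.integral_cong simp del: times_divide_eq_right)
      moreover have "(\<lambda>t. Ky t * bump p q t) integrable_on {p..q}"
        using sub ab by (intro integrable_continuous_interval continuous_on_mult continuous_on_bump continuous_on_subset[OF Ky]) auto
      moreover have "(\<lambda>t. bump_deriv p q t * (frac_right \<alpha> B Ku t / Gamma (1 - \<alpha>))) integrable_on {p..q}"
        "(\<lambda>t. bump_deriv p q t * (frac_left \<beta> A Kv t / Gamma (1 - \<beta>))) integrable_on {p..q}"
        by (intro integrable_continuous_interval continuous_on_mult continuous_on_bump_deriv c1 c2)+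
      moreover have "(\<lambda>t. Ky t * bump p q t + (frac_right \<alpha> B Ku t / Gamma (1 - \<alpha>) - frac_left \<beta> A Kv t / Gamma (1 - \<beta>)) * bump_deriv p q t) =
        (\<lambda>t. Ky t * bump p q t + bump_deriv p q t * (frac_right \<alpha> B Ku t / Gamma (1 - \<alpha>)) - bump_deriv p q t * (frac_left \<beta> A Kv t / Gamma (1 - \<beta>)))"
        by (auto simp: algebra_simps)
      ultimately show "integral {p..q} (\<lambda>t. Ky t * bump p q t +
          (frac_right \<alpha> B Ku t / Gamma (1 - \<alpha>) - frac_left \<beta> A Kv t / Gamma (1 - \<beta>)) * bump_deriv p q t) = 0"
        using V[of p q] pq ab
        by (simp only: Henstock_Kurzweil_Integration.integral_add Henstock_Kurzweil_Integration.integral_diff integrable_add)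
    qed
    then show ?thesis by simp
  qed
  show "right_RL \<alpha> a B Ku x - right_RL \<alpha> a A Ku x = 0" if x: "x \<in> {a<..<A}" for x
  proof -
    have aA: "a < A" "a < B" "A \<le> b" "a \<le> a" using x ab by auto
    note R1 = right_RL_truncated[OF \<alpha> aA(4,2) ab(3) Ku] and R2 = right_RL_truncated[OF \<alpha> aA(4,1,3) Ku]
    have P: "P t = (frac_right \<alpha> B Ku t - frac_right \<alpha> A Ku t) / Gamma (1 - \<alpha>)" if "t \<in> {a<..<A}" for t
    proof -
      have "(\<lambda>x. (x - t) powr (- \<alpha>) * Ku x) integrable_on {t..B}"
        using that ab by (intro frac_right_integrable \<alpha> continuous_on_subset[OF Ku(1)]) auto
      then have "frac_right \<alpha> A Ku t + integral {A..B} (\<lambda>x. (x - t) powr (- \<alpha>) * Ku x) = frac_right \<alpha> B Ku t"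
        unfolding frac_right_def using that ab by (intro Henstock_Kurzweil_Integration.integral_combine) auto
      then show ?thesis using that by (simp add: P_def max_def)
    qed
    \<comment> \<open>A bump left of \<open>A\<close> misses \<open>[A,B]\<close>, which gives
      \<open>\<Phi> = 0\<close>, and for \<open>t < A\<close> the range of integration in
      \<open>Q t\<close> is empty. \<open>P\<close> is the difference of the integrals up to
      \<open>B\<close> and up to \<open>A\<close>.\<close>
    have "0 = - right_RL \<alpha> a B Ku x + right_RL \<alpha> a A Ku x"
    proof (rule du_bois_reymond_bump[OF _ _ _ _ x, where \<Phi> = "\<lambda>_. 0"])
      have "continuous_on {a<..<A} (right_RL \<alpha> a B Ku)" using R1(3) by (rule continuous_on_subset) (use ab in auto)
      then show "continuous_on {a<..<A} (\<lambda>x. - right_RL \<alpha> a B Ku x + right_RL \<alpha> a A Ku x)"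
        by (intro continuous_on_add continuous_on_minus R2(3))
      show "((\<lambda>t. (frac_right \<alpha> B Ku t - frac_right \<alpha> A Ku t) / Gamma (1 - \<alpha>)) has_real_derivative
          - right_RL \<alpha> a B Ku t + right_RL \<alpha> a A Ku t) (at t)" if "t \<in> {a<..<A}" for t
        using DERIV_cdivide[OF DERIV_diff[OF R1(2) R2(2)[OF that]], of "Gamma (1 - \<alpha>)"] that ab G\<alpha>
        by (simp add: diff_divide_distrib add_divide_distrib)
      fix p q assume pq: "a < p" "p < q" "q < A"
      have "integral {A..B} (\<lambda>x. Ky x * bump p q x) = integral {A..B} (\<lambda>x. 0)"
        using pq by (intro Henstock_Kurzweil_Integration.integral_cong) (auto simp: bump_outside)
      moreover have "integral {p..q} (\<lambda>t. bump_deriv p q t * Q t) = integral {p..q} (\<lambda>t. 0)"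
        using pq ab by (intro Henstock_Kurzweil_Integration.integral_cong) (auto simp: Q_def min_def)
      moreover have "integral {p..q} (\<lambda>t. bump_deriv p q t * P t) =
          integral {p..q} (\<lambda>t. 0 * bump p q t + (frac_right \<alpha> B Ku t - frac_right \<alpha> A Ku t) / Gamma (1 - \<alpha>) * bump_deriv p q t)"
        using pq by (intro Henstock_Kurzweil_Integration.integral_cong) (auto simp: P)
      ultimately show "integral {p..q} (\<lambda>t. 0 * bump p q t +
          (frac_right \<alpha> B Ku t - frac_right \<alpha> A Ku t) / Gamma (1 - \<alpha>) * bump_deriv p q t) = 0"
        using V[of p q] pq ab by simp
    qed simp
    then show ?thesis by simp
  qed
  show "left_RL \<beta> A b Kv x - left_RL \<beta> B b Kv x = 0" if x: "x \<in> {B<..<b}" for x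
  proof -
    have Bb: "a \<le> B" "B < b" "A < b" "b \<le> b" using x ab by auto
    note L1 = left_RL_truncated[OF \<beta> ab(1) Bb(3,4) Kv] and L2 = left_RL_truncated[OF \<beta> Bb(1,2,4) Kv]
    have Q: "Q t = (frac_left \<beta> A Kv t - frac_left \<beta> B Kv t) / Gamma (1 - \<beta>)" if "t \<in> {B<..<b}" for t
    proof -
      have "(\<lambda>x. (t - x) powr (- \<beta>) * Kv x) integrable_on {A..t}"
        using that ab by (intro frac_left_integrable \<beta> continuous_on_subset[OF Kv(1)]) auto
      then have "integral {A..B} (\<lambda>x. (t - x) powr (- \<beta>) * Kv x) + frac_left \<beta> B Kv t = frac_left \<beta> A Kv t"
        unfolding frac_left_def using that ab by (intro Henstock_Kurzweil_Integration.integral_combine) auto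
      then have "integral {A..B} (\<lambda>x. (t - x) powr (- \<beta>) * Kv x) = frac_left \<beta> A Kv t - frac_left \<beta> B Kv t"
        by linarith
      then show ?thesis using that by (simp add: Q_def min_def)
    qed
    \<comment> \<open>Right of \<open>B\<close> it is \<open>P t\<close> whose range is empty. The
      variation is then minus the integral of \<open>bump_deriv * Q\<close>; the sign is dropped and
      \<open>\<Psi> = Q\<close>.\<close>
    have "0 = left_RL \<beta> A b Kv x - left_RL \<beta> B b Kv x"
    proof (rule du_bois_reymond_bump[OF _ _ _ _ x, where \<Phi> = "\<lambda>_. 0"])
      have "continuous_on {B<..<b} (left_RL \<beta> A b Kv)" using L1(3) by (rule continuous_on_subset) (use ab in auto)
      then show "continuous_on {B<..<b} (\<lambda>x. left_RL \<beta> A b Kv x - left_RL \<beta> B b Kv x)"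
        by (intro continuous_on_diff L2(3))
      show "((\<lambda>t. (frac_left \<beta> A Kv t - frac_left \<beta> B Kv t) / Gamma (1 - \<beta>)) has_real_derivative
          left_RL \<beta> A b Kv t - left_RL \<beta> B b Kv t) (at t)" if "t \<in> {B<..<b}" for t
        using DERIV_cdivide[OF DERIV_diff[OF L1(2) L2(2)[OF that]], of "Gamma (1 - \<beta>)"] that ab G\<beta>
        by (simp add: diff_divide_distrib)
      fix p q assume pq: "B < p" "p < q" "q < b"
      have "integral {A..B} (\<lambda>x. Ky x * bump p q x) = integral {A..B} (\<lambda>x. 0)"
        using pq by (intro Henstock_Kurzweil_Integration.integral_cong) (auto simp: bump_outside)
      moreover have "integral {p..q} (\<lambda>t. bump_deriv p q t * P t) = integral {p..q} (\<lambda>t. 0)"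
        using pq ab by (intro Henstock_Kurzweil_Integration.integral_cong) (auto simp: P_def max_def)
      moreover have "integral {p..q} (\<lambda>t. bump_deriv p q t * Q t) =
          integral {p..q} (\<lambda>t. 0 * bump p q t + (frac_left \<beta> A Kv t - frac_left \<beta> B Kv t) / Gamma (1 - \<beta>) * bump_deriv p q t)"
        using pq by (intro Henstock_Kurzweil_Integration.integral_cong) (auto simp: Q)
      ultimately show "integral {p..q} (\<lambda>t. 0 * bump p q t +
          (frac_left \<beta> A Kv t - frac_left \<beta> B Kv t) / Gamma (1 - \<beta>) * bump_deriv p q t) = 0"
        using V[of p q] pq ab by simp
    qed simp
    then show ?thesis by simp
  qed
qed

subsection \<open>Variations with two parameters\<close>

text \<open>The open mapping theorem used here asks for continuity and for a right-invertible
  derivative at the single point 0. The image of \<open>T\<close> then contains points over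
  \<open>I 0\<close> with \<open>J\<close> above and below \<open>J 0\<close>, which refutes a
  minimum and a maximum at once.\<close>

lemma extremum_two_parameters:
  fixes I J :: "real \<times> real \<Rightarrow> real"
  assumes cont: "continuous_on UNIV I" "continuous_on UNIV J"
    and dI: "(I has_derivative (\<lambda>(s, t). s * i1 + t * i2)) (at 0)"
    and dJ: "(J has_derivative (\<lambda>(s, t). s * j1 + t * j2)) (at 0)"
    and T: "0 \<in> interior T"
    and opt: "(\<forall>\<epsilon>\<in>T. I \<epsilon> = I 0 \<longrightarrow> J 0 \<le> J \<epsilon>) \<or> (\<forall>\<epsilon>\<in>T. I \<epsilon> = I 0 \<longrightarrow> J \<epsilon> \<le> J 0)"
  shows "i1 * j2 = i2 * j1"
proof (rule ccontr)
  assume neq: "i1 * j2 \<noteq> i2 * j1"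
  define d where "d = i1 * j2 - i2 * j1"
  have d: "d \<noteq> 0" using neq by (simp add: d_def)
  define f where "f = (\<lambda>\<epsilon>. (I \<epsilon>, J \<epsilon>))"
  define f' where "f' = (\<lambda>(s, t). (s * i1 + t * i2, s * j1 + t * j2))"
  \<comment> \<open>The inverse of the Jacobian matrix by Cramer's rule, \<open>d\<close> being the
    determinant.\<close>
  define g' where "g' = (\<lambda>(u, w). ((u * j2 - w * i2) / d, (w * i1 - u * j1) / d))"
  have "(f has_derivative (\<lambda>h. ((\<lambda>(s, t). s * i1 + t * i2) h, (\<lambda>(s, t). s * j1 + t * j2) h))) (at 0)"
    unfolding f_def by (rule has_derivative_Pair[OF dI dJ])
  then have f': "(f has_derivative f') (at 0)"
    by (simp add: f'_def split_def)
  have g': "bounded_linear g'"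
    unfolding linear_conv_bounded_linear[symmetric]
    by (rule linearI) (auto simp: g'_def algebra_simps add_divide_distrib diff_divide_distrib)
  have inv: "f' \<circ> g' = id"
  proof (rule ext)
    fix p :: "real \<times> real"
    obtain u w where p: "p = (u, w)" by (cases p)
    have "(u * j2 - w * i2) * i1 + (w * i1 - u * j1) * i2 = u * d"
      and "(u * j2 - w * i2) * j1 + (w * i1 - u * j1) * j2 = w * d"
      by (auto simp: d_def algebra_simps)
    then have "(u * j2 - w * i2) / d * i1 + (w * i1 - u * j1) / d * i2 = u"
      and "(u * j2 - w * i2) / d * j1 + (w * i1 - u * j1) / d * j2 = w"
      using d by (auto simp: field_simps)
    then show "(f' \<circ> g') p = id p"
      by (simp add: p f'_def g'_def)
  qed
  have "f 0 \<in> interior (f ` T)"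
    by (rule sussmann_open_mapping[OF open_UNIV _ _ f' g' inv])
      (use T cont in \<open>auto simp: f_def intro!: continuous_on_Pair\<close>)
  then obtain e where "0 < e" and e: "cball (f 0) e \<subseteq> f ` T"
    using mem_interior_cball by blast
  have "(I 0, J 0 - e) \<in> cball (f 0) e" "(I 0, J 0 + e) \<in> cball (f 0) e"
    using \<open>0 < e\<close> by (auto simp: f_def dist_prod_def dist_real_def)
  then obtain \<epsilon> \<epsilon>' where "\<epsilon> \<in> T" "I \<epsilon> = I 0" "J \<epsilon> = J 0 - e" "\<epsilon>' \<in> T" "I \<epsilon>' = I 0" "J \<epsilon>' = J 0 + e"
    using e unfolding f_def by (smt (verit) imageE prod.inject subset_iff)
  then show False
    using opt \<open>0 < e\<close> by force
qed

text \<open>The strip is unbounded in \<open>(y, u, v)\<close>, so the varied arguments stay in it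
  for every \<open>\<epsilon>\<close>. Differentiation under the integral over the compact
  \<open>[A,B]\<close> then works at every \<open>\<epsilon>\<close>, which also yields the global
  continuity.\<close>

lemma functional_two_parameters:
  fixes q h1 h2 :: "real \<Rightarrow> real \<times> real \<times> real"
  assumes F: "C1_on (strip a b) F" and AB: "a \<le> A" "B \<le> b"
    and q: "continuous_on {A..B} q" and h1: "continuous_on {A..B} h1" and h2: "continuous_on {A..B} h2"
  defines "\<Phi> \<equiv> \<lambda>\<epsilon> :: real \<times> real. integral {A..B} (\<lambda>x. F (x, q x + fst \<epsilon> *\<^sub>R h1 x + snd \<epsilon> *\<^sub>R h2 x))"
  shows "continuous_on UNIV \<Phi>"
    and "(\<Phi> has_derivative (\<lambda>(s, t). s * integral {A..B} (\<lambda>x. vgrad a b F (x, q x) (h1 x)) +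
      t * integral {A..B} (\<lambda>x. vgrad a b F (x, q x) (h2 x)))) (at 0)"
proof -
  define w where "w \<epsilon> x = q x + fst \<epsilon> *\<^sub>R h1 x + snd \<epsilon> *\<^sub>R h2 x" for \<epsilon> :: "real \<times> real" and x
  define D :: "real \<times> real \<Rightarrow> real \<Rightarrow> (real \<times> real) \<Rightarrow>\<^sub>L real" where "D \<epsilon> x = vgrad a b F (x, w \<epsilon> x) (h1 x) *\<^sub>R fst_blinfun + vgrad a b F (x, w \<epsilon> x) (h2 x) *\<^sub>R snd_blinfun"
    for \<epsilon> :: "real \<times> real" and x
  have wc: "continuous_on (UNIV \<times> {A..B}) (\<lambda>p. (snd p, w (fst p) (snd p)))"
    unfolding w_def
    by (intro continuous_intros continuous_on_compose2[OF q] continuous_on_compose2[OF h1] continuous_on_compose2[OF h2]) auto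
  have gc: "continuous_on (UNIV \<times> {A..B}) (\<lambda>p. vgrad a b F (snd p, w (fst p) (snd p)))"
    by (rule continuous_on_compose2[OF continuous_on_vgrad[OF F] wc]) (use AB in auto)
  have Fc: "continuous_on (UNIV \<times> {A..B}) (\<lambda>p. F (snd p, w (fst p) (snd p)))"
    by (rule continuous_on_compose2[OF C1_on_strip_continuous[OF F] wc]) (use AB in auto)
  have Dc: "continuous_on (UNIV \<times> {A..B}) (\<lambda>(\<epsilon>, x). D \<epsilon> x)"
    unfolding D_def split_beta
    by (intro continuous_on_add continuous_on_scaleR continuous_on_const blinfun.continuous_on gc
        continuous_on_compose2[OF h1] continuous_on_compose2[OF h2] continuous_on_snd continuous_on_id) auto
  have slice: "continuous_on {A..B} (\<lambda>x. G \<epsilon> x)" if "continuous_on (UNIV \<times> {A..B}) (\<lambda>p. G (fst p) (snd p))"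
    for G :: "real \<times> real \<Rightarrow> real \<Rightarrow> 'c::topological_space" and \<epsilon>
  proof -
    have "continuous_on {A..B} (Pair \<epsilon>)"
      by (intro continuous_on_Pair continuous_on_const continuous_on_id)
    from continuous_on_compose2[OF that this] show ?thesis by auto
  qed
  have der: "(\<Phi> has_derivative integral {A..B} (D \<epsilon>)) (at \<epsilon>)" for \<epsilon>
  proof -
    have "((\<lambda>\<epsilon>. integral (cbox A B) (\<lambda>x. F (x, w \<epsilon> x))) has_derivative integral (cbox A B) (D \<epsilon>)) (at \<epsilon> within UNIV)"
    proof (rule leibniz_rule)
      show "((\<lambda>\<epsilon>. F (x, w \<epsilon> x)) has_derivative blinfun_apply (D \<epsilon> x)) (at \<epsilon> within UNIV)"
        if "x \<in> cbox A B" for \<epsilon> x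
      proof -
        have "((\<lambda>\<epsilon>. w \<epsilon> x) has_derivative (\<lambda>\<epsilon>. fst \<epsilon> *\<^sub>R h1 x + snd \<epsilon> *\<^sub>R h2 x)) (at \<epsilon>)"
          unfolding w_def by (auto intro!: derivative_eq_intros)
        moreover have "((\<lambda>q. F (x, q)) has_derivative vgrad a b F (x, w \<epsilon> x)) (at (w \<epsilon> x))"
          using that AB by (intro C1_on_strip_derivative[OF F]) auto
        ultimately have "((\<lambda>\<epsilon>. F (x, w \<epsilon> x)) has_derivative (\<lambda>\<epsilon>'. vgrad a b F (x, w \<epsilon> x) (fst \<epsilon>' *\<^sub>R h1 x + snd \<epsilon>' *\<^sub>R h2 x))) (at \<epsilon>)"
          by (rule has_derivative_compose)
        moreover have "(\<lambda>\<epsilon>'. vgrad a b F (x, w \<epsilon> x) (fst \<epsilon>' *\<^sub>R h1 x + snd \<epsilon>' *\<^sub>R h2 x)) = blinfun_apply (D \<epsilon> x)"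
          by (auto simp: D_def blinfun.add_left blinfun.add_right blinfun.scaleR_left blinfun.scaleR_right)
        ultimately show ?thesis by simp
      qed
      show "(\<lambda>x. F (x, w \<epsilon> x)) integrable_on cbox A B" for \<epsilon>
        using slice[OF Fc] by (intro integrable_continuous) simp
    qed (use Dc in auto)
    then show ?thesis by (simp add: \<Phi>_def w_def)
  qed
  show "continuous_on UNIV \<Phi>"
    using der by (auto intro!: continuous_at_imp_continuous_on has_derivative_continuous)
  have "blinfun_apply (integral {A..B} (D 0)) (s, t) = s * integral {A..B} (\<lambda>x. vgrad a b F (x, q x) (h1 x)) +
      t * integral {A..B} (\<lambda>x. vgrad a b F (x, q x) (h2 x))" for s t
  proof -
    have g0: "continuous_on {A..B} (\<lambda>x. vgrad a b F (x, w 0 x))"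
      by (rule slice[OF gc])
    have w0: "w 0 x = q x" for x by (simp add: w_def)
    have "D 0 integrable_on {A..B}"
      using Dc by (intro integrable_continuous_interval slice) (simp add: split_beta)
    then have "blinfun_apply (integral {A..B} (D 0)) (s, t) = integral {A..B} (\<lambda>x. D 0 x (s, t))"
      by (rule blinfun_apply_integral)
    also have "\<dots> = integral {A..B} (\<lambda>x. s * vgrad a b F (x, q x) (h1 x) + t * vgrad a b F (x, q x) (h2 x))"
      by (simp add: D_def w0 blinfun.add_left blinfun.scaleR_left mult.commute)
    also have "\<dots> = integral {A..B} (\<lambda>x. s * vgrad a b F (x, q x) (h1 x)) + integral {A..B} (\<lambda>x. t * vgrad a b F (x, q x) (h2 x))"
      using g0 unfolding w0
      by (intro Henstock_Kurzweil_Integration.integral_add integrable_continuous_interval continuous_on_mult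
          continuous_on_const blinfun.continuous_on h1 h2)
    finally show ?thesis by simp
  qed
  then have "blinfun_apply (integral {A..B} (D 0)) = (\<lambda>(s, t). s * integral {A..B} (\<lambda>x. vgrad a b F (x, q x) (h1 x)) +
      t * integral {A..B} (\<lambda>x. vgrad a b F (x, q x) (h2 x)))"
    by auto
  then show "(\<Phi> has_derivative (\<lambda>(s, t). s * integral {A..B} (\<lambda>x. vgrad a b F (x, q x) (h1 x)) +
      t * integral {A..B} (\<lambda>x. vgrad a b F (x, q x) (h2 x)))) (at 0)"
    using der[of 0] by simp
qed

subsection \<open>Necessary conditions\<close>

text \<open>The partial derivatives of \<open>K\<close> along \<open>y\<close> are known to be
  linear combinations of those of \<open>L\<close> and \<open>g\<close> only on
  \<open>[a,b]\<close>, so regularity has to be transferred between functions that agree just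
  there.\<close>

lemma continuous_left_RL_cong:
  assumes "\<gamma> < 1" "c < d" "continuous_left_RL \<gamma> c d f" and eq: "\<And>x. x \<in> {c..d} \<Longrightarrow> f x = g x"
  shows "continuous_left_RL \<gamma> c d g"
proof (rule left_RL_eqI(1)[OF assms(1,2)])
  show "continuous_on {c..d} (left_RL \<gamma> c d f)" using assms(3) by (simp add: continuous_left_RL_def)
  show "(frac_left \<gamma> c g has_real_derivative Gamma (1 - \<gamma>) * left_RL \<gamma> c d f x) (at x within {c..d})"
    if x: "x \<in> {c<..d}" for x
    by (rule has_field_derivative_transform_within[OF continuous_left_RL_derivative[OF assms(1-3) x], where d = 1])
      (use x in \<open>auto simp: frac_left_def intro!: Henstock_Kurzweil_Integration.integral_cong eq\<close>)
qed

lemma continuous_right_RL_cong: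
  assumes "\<gamma> < 1" "c < d" "continuous_right_RL \<gamma> c d f" and eq: "\<And>x. x \<in> {c..d} \<Longrightarrow> f x = g x"
  shows "continuous_right_RL \<gamma> c d g"
proof (rule right_RL_eqI(1)[OF assms(1,2)])
  show "continuous_on {c..d} (right_RL \<gamma> c d f)" using assms(3) by (simp add: continuous_right_RL_def)
  show "(frac_right \<gamma> d g has_real_derivative - (Gamma (1 - \<gamma>) * right_RL \<gamma> c d f x)) (at x within {c..d})"
    if x: "x \<in> {c..<d}" for x
    by (rule has_field_derivative_transform_within[OF continuous_right_RL_derivative[OF assms(1-3) x], where d = 1])
      (use x in \<open>auto simp: frac_right_def intro!: Henstock_Kurzweil_Integration.integral_cong eq\<close>)
qed

text \<open>One coordinate at a time, by a shift of \<open>- u\<close> or \<open>- v\<close> along a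
  direction on which \<open>F\<close> does not depend.\<close>

lemma strip_omit_absent:
  assumes "l \<or> \<not> depends_on (strip a b) dir_u F" "r \<or> \<not> depends_on (strip a b) dir_v F" "x \<in> {a..b}"
  shows "F (x, y, (if l then u else 0), (if r then v else 0)) = F (x, y, u, v)"
    and "partial (strip a b) (0, e) F (x, y, (if l then u else 0), (if r then v else 0)) = partial (strip a b) (0, e) F (x, y, u, v)"
proof -
  have u: "F (x, y, (if l then u else 0), v) = F (x, y, u, v)"
    "partial (strip a b) (0, e) F (x, y, (if l then u else 0), v) = partial (strip a b) (0, e) F (x, y, u, v)" for v
    using not_depends_on_strip[of a b "(0, 1, 0)" F x "(y, u, v)" "- u"]
      not_depends_on_strip_partial[of a b "(0, 1, 0)" F x e "(y, u, v)" "- u"] assms by auto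
  have v: "F (x, y, u, (if r then v else 0)) = F (x, y, u, v)"
    "partial (strip a b) (0, e) F (x, y, u, (if r then v else 0)) = partial (strip a b) (0, e) F (x, y, u, v)" for u
    using not_depends_on_strip[of a b "(0, 0, 1)" F x "(y, u, v)" "- v"]
      not_depends_on_strip_partial[of a b "(0, 0, 1)" F x e "(y, u, v)" "- v"] assms by auto
  show "F (x, y, (if l then u else 0), (if r then v else 0)) = F (x, y, u, v)"
    and "partial (strip a b) (0, e) F (x, y, (if l then u else 0), (if r then v else 0)) = partial (strip a b) (0, e) F (x, y, u, v)"
    by (simp_all only: u v)
qed

lemma admissible_linear:
  assumes "a < b" "0 < \<alpha>" "\<alpha> < 1" "0 < \<beta>" "\<beta> < 1"
    and f: "f \<in> admissible \<alpha> \<beta> a b L g" and h: "h \<in> admissible \<alpha> \<beta> a b L g"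
  shows "(\<lambda>x. p * f x + q * h x) \<in> admissible \<alpha> \<beta> a b L g"
proof -
  have "continuous_on {a..b} f" "continuous_on {a..b} h"
    using f h by (auto simp: admissible_def)
  then show ?thesis
    using f h left_RL_linear(1)[OF assms(2,3,1), of f h p q] right_RL_linear(1)[OF assms(4,5,1), of f h p q]
    by (auto simp: admissible_def intro!: continuous_intros)
qed

lemma bump_admissible:
  assumes "0 < \<alpha>" "\<alpha> < 1" "0 < \<beta>" "\<beta> < 1" "a \<le> p" "p < q" "q \<le> b"
  shows "bump p q \<in> admissible \<alpha> \<beta> a b L g"
  using left_RL_bump(1)[OF assms(1,2,5-7)] right_RL_bump(1)[OF assms(3-7)] continuous_on_bump
  by (auto simp: admissible_def)

text \<open>The arguments \<open>(y, u, v)\<close> along \<open>y\<close>, with absent derivatives replaced by \<open>0\<close>; unlike \<open>along\<close>,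
  this is continuous for every admissible \<open>y\<close>.\<close>

definition present_args ::
  "real \<Rightarrow> real \<Rightarrow> real \<Rightarrow> real \<Rightarrow> (point \<Rightarrow> real) \<Rightarrow> (point \<Rightarrow> real) \<Rightarrow> (real \<Rightarrow> real) \<Rightarrow> real \<Rightarrow> real \<times> real \<times> real" where
  "present_args \<alpha> \<beta> a b L g y x =
    (y x, (if left_present a b L g then left_RL \<alpha> a b y x else 0), (if right_present a b L g then right_RL \<beta> a b y x else 0))"

lemma present_args_along:
  assumes "F = L \<or> F = g" "x \<in> {a..b}"
  shows "F (x, present_args \<alpha> \<beta> a b L g y x) = F (along \<alpha> \<beta> a b y x)"
    and "partial (strip a b) (0, e) F (x, present_args \<alpha> \<beta> a b L g y x) = partial (strip a b) (0, e) F (along \<alpha> \<beta> a b y x)"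
proof -
  have "left_present a b L g \<or> \<not> depends_on (strip a b) dir_u F" "right_present a b L g \<or> \<not> depends_on (strip a b) dir_v F"
    using assms(1) by (auto simp: left_present_def right_present_def)
  from strip_omit_absent[OF this assms(2)]
  show "F (x, present_args \<alpha> \<beta> a b L g y x) = F (along \<alpha> \<beta> a b y x)"
    and "partial (strip a b) (0, e) F (x, present_args \<alpha> \<beta> a b L g y x) = partial (strip a b) (0, e) F (along \<alpha> \<beta> a b y x)"
    by (simp_all only: present_args_def along_def)
qed

lemma continuous_on_present_args:
  assumes "y \<in> admissible \<alpha> \<beta> a b L g"
  shows "continuous_on {a..b} (present_args \<alpha> \<beta> a b L g y)"
  using assms unfolding present_args_def admissible_def continuous_left_RL_def continuous_right_RL_def
  by (cases "left_present a b L g"; cases "right_present a b L g") (auto intro!: continuous_intros)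

lemma present_args_linear:
  assumes "a < b" "0 < \<alpha>" "\<alpha> < 1" "0 < \<beta>" "\<beta> < 1"
    and f: "f \<in> admissible \<alpha> \<beta> a b L g" and h: "h \<in> admissible \<alpha> \<beta> a b L g" and x: "x \<in> {a..b}"
  shows "present_args \<alpha> \<beta> a b L g (\<lambda>x. p * f x + q * h x) x =
    p *\<^sub>R present_args \<alpha> \<beta> a b L g f x + q *\<^sub>R present_args \<alpha> \<beta> a b L g h x"
proof -
  have "continuous_on {a..b} f" "continuous_on {a..b} h"
    using f h by (auto simp: admissible_def)
  then show ?thesis
    using f h x left_RL_linear(2)[OF assms(2,3,1), of f h] right_RL_linear(2)[OF assms(4,5,1), of f h]
    by (auto simp: admissible_def present_args_def)
qed

text \<open>The variations vanish at \<open>a\<close> and \<open>b\<close>, so every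
  \<open>z \<epsilon>\<close> keeps the boundary values, and membership in \<open>C\<close> reduces
  to the single equation \<open>\<Phi> g \<epsilon> = \<Phi> g 0\<close> in the plane of
  parameters.\<close>

lemma isoperimetric_variations:
  fixes a b A B \<alpha> \<beta> l ya yb :: real
  assumes ab: "a \<le> A" "A < B" "B \<le> b" and \<alpha>: "0 < \<alpha>" "\<alpha> < 1" and \<beta>: "0 < \<beta>" "\<beta> < 1"
    and L: "C1_on (strip a b) L" and g: "C1_on (strip a b) g"
    and N: "norm_on a b (admissible \<alpha> \<beta> a b L g) N"
    and C: "C = {z \<in> admissible \<alpha> \<beta> a b L g. z a = ya \<and> z b = yb \<and> functional \<alpha> \<beta> a b A B g z = l}"
    and opt: "local_minimizer N C (functional \<alpha> \<beta> a b A B L) y \<or> local_maximizer N C (functional \<alpha> \<beta> a b A B L) y"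
    and h1: "h1 \<in> admissible \<alpha> \<beta> a b L g" "h1 a = 0" "h1 b = 0"
    and h2: "h2 \<in> admissible \<alpha> \<beta> a b L g" "h2 a = 0" "h2 b = 0"
  defines "q \<equiv> present_args \<alpha> \<beta> a b L g"
  defines "\<delta> \<equiv> \<lambda>F h. integral {A..B} (\<lambda>x. vgrad a b F (x, q y x) (q h x))"
  shows "\<delta> g h1 * \<delta> L h2 = \<delta> g h2 * \<delta> L h1"
proof -
  have "a < b" using ab by simp
  note lin = admissible_linear[OF \<open>a < b\<close> \<alpha> \<beta>] and plin = present_args_linear[OF \<open>a < b\<close> \<alpha> \<beta>]
  have y: "y \<in> C" using opt by (auto simp: local_minimizer_def local_maximizer_def)
  then have yadm: "y \<in> admissible \<alpha> \<beta> a b L g" by (simp add: C)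
  \<comment> \<open>The factors 1 give \<open>z \<epsilon>\<close> the shape of a combination of two
    admissible functions that the linearity lemmas expect.\<close>
  define z where "z = (\<lambda>\<epsilon> :: real \<times> real. \<lambda>x. 1 * y x + 1 * (fst \<epsilon> * h1 x + snd \<epsilon> * h2 x))"
  define \<Phi> where "\<Phi> F \<epsilon> = integral {A..B} (\<lambda>x. F (x, q y x + fst \<epsilon> *\<^sub>R q h1 x + snd \<epsilon> *\<^sub>R q h2 x))"
    for F :: "point \<Rightarrow> real" and \<epsilon> :: "real \<times> real"
  have hadm: "(\<lambda>x. s * h1 x + t * h2 x) \<in> admissible \<alpha> \<beta> a b L g" for s t
    by (rule lin[OF h1(1) h2(1)])
  have zadm: "z \<epsilon> \<in> admissible \<alpha> \<beta> a b L g" for \<epsilon>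
    unfolding z_def by (rule lin[OF yadm hadm])
  have qz: "q (z \<epsilon>) x = q y x + fst \<epsilon> *\<^sub>R q h1 x + snd \<epsilon> *\<^sub>R q h2 x" if "x \<in> {a..b}" for \<epsilon> x
    unfolding q_def z_def plin[OF yadm hadm that] plin[OF h1(1) h2(1) that] by simp
  have \<Phi>: "functional \<alpha> \<beta> a b A B F (z \<epsilon>) = \<Phi> F \<epsilon>" if "F = L \<or> F = g" for F \<epsilon>
    unfolding functional_def \<Phi>_def
  proof (rule Henstock_Kurzweil_Integration.integral_cong)
    fix x assume "x \<in> {A..B}"
    then have x: "x \<in> {a..b}" using ab by auto
    show "F (along \<alpha> \<beta> a b (z \<epsilon>) x) = F (x, q y x + fst \<epsilon> *\<^sub>R q h1 x + snd \<epsilon> *\<^sub>R q h2 x)"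
      using present_args_along(1)[OF that x, of \<alpha> \<beta> "z \<epsilon>"] qz[OF x] by (simp add: q_def)
  qed
  have z0: "z 0 = y" by (simp add: z_def)
  have zC: "z \<epsilon> \<in> C" if "\<Phi> g \<epsilon> = \<Phi> g 0" for \<epsilon>
    using y that zadm h1 h2 \<Phi>[of g \<epsilon>] \<Phi>[of g 0] unfolding z0 by (simp add: C) (simp add: z_def)
  have qc: "continuous_on {A..B} (q h)" if "h \<in> admissible \<alpha> \<beta> a b L g" for h
    using continuous_on_present_args[OF that] unfolding q_def by (rule continuous_on_subset) (use ab in auto)
  note var = functional_two_parameters[OF _ ab(1,3) qc[OF yadm] qc[OF h1(1)] qc[OF h2(1)], folded \<Phi>_def \<delta>_def]
  obtain \<delta>0 where \<delta>0: "\<delta>0 > 0" and near_opt: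
    "(\<forall>y1\<in>C. N (\<lambda>x. y x - y1 x) < \<delta>0 \<longrightarrow> functional \<alpha> \<beta> a b A B L y \<le> functional \<alpha> \<beta> a b A B L y1) \<or>
     (\<forall>y1\<in>C. N (\<lambda>x. y x - y1 x) < \<delta>0 \<longrightarrow> functional \<alpha> \<beta> a b A B L y1 \<le> functional \<alpha> \<beta> a b A B L y)"
    using opt unfolding local_minimizer_def local_maximizer_def by blast
  \<comment> \<open>The left-hand side bounds the norm of \<open>y - z \<epsilon>\<close> and is
    continuous in \<open>\<epsilon>\<close>, so \<open>T\<close> is an open set of allowed
    parameters whatever norm \<open>N\<close> is.\<close>
  define T where "T = {\<epsilon> :: real \<times> real. \<bar>fst \<epsilon>\<bar> * N h1 + \<bar>snd \<epsilon>\<bar> * N h2 < \<delta>0}"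
  have "open T"
    unfolding T_def by (intro open_Collect_less continuous_intros)
  then have T: "0 \<in> interior T"
    using \<delta>0 by (simp add: interior_open T_def)
  have near: "N (\<lambda>x. y x - z \<epsilon> x) < \<delta>0" if "\<epsilon> \<in> T" for \<epsilon>
  proof -
    have scale: "(\<lambda>x. c * h x) \<in> admissible \<alpha> \<beta> a b L g" if "h \<in> admissible \<alpha> \<beta> a b L g" for c h
      using lin[OF that that, of c 0] by simp
    have homogeneous: "N (\<lambda>x. c * h x) = \<bar>c\<bar> * N h" if "h \<in> admissible \<alpha> \<beta> a b L g" for c h
      using N that unfolding norm_on_def by blast
    have triangle: "N (\<lambda>x. f x + h x) \<le> N f + N h"
      if "f \<in> admissible \<alpha> \<beta> a b L g" "h \<in> admissible \<alpha> \<beta> a b L g" for f h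
      using N that unfolding norm_on_def by blast
    have "N (\<lambda>x. y x - z \<epsilon> x) = N (\<lambda>x. - fst \<epsilon> * h1 x + - snd \<epsilon> * h2 x)"
      by (simp add: z_def algebra_simps)
    also have "\<dots> \<le> N (\<lambda>x. - fst \<epsilon> * h1 x) + N (\<lambda>x. - snd \<epsilon> * h2 x)"
      by (rule triangle[OF scale[OF h1(1)] scale[OF h2(1)]])
    also have "\<dots> = \<bar>- fst \<epsilon>\<bar> * N h1 + \<bar>- snd \<epsilon>\<bar> * N h2"
      by (simp only: homogeneous[OF h1(1)] homogeneous[OF h2(1)])
    finally show ?thesis using that by (simp add: T_def)
  qed
  have LJ: "functional \<alpha> \<beta> a b A B L (z \<epsilon>) = \<Phi> L \<epsilon>" for \<epsilon> by (rule \<Phi>) simp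
  have "(\<forall>\<epsilon>\<in>T. \<Phi> g \<epsilon> = \<Phi> g 0 \<longrightarrow> \<Phi> L 0 \<le> \<Phi> L \<epsilon>) \<or> (\<forall>\<epsilon>\<in>T. \<Phi> g \<epsilon> = \<Phi> g 0 \<longrightarrow> \<Phi> L \<epsilon> \<le> \<Phi> L 0)"
    using near_opt
  proof
    assume *: "\<forall>y1\<in>C. N (\<lambda>x. y x - y1 x) < \<delta>0 \<longrightarrow> functional \<alpha> \<beta> a b A B L y \<le> functional \<alpha> \<beta> a b A B L y1"
    show ?thesis
      using *[rule_format, OF zC near] LJ LJ[of 0, unfolded z0] by (intro disjI1) simp
  next
    assume *: "\<forall>y1\<in>C. N (\<lambda>x. y x - y1 x) < \<delta>0 \<longrightarrow> functional \<alpha> \<beta> a b A B L y1 \<le> functional \<alpha> \<beta> a b A B L y"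
    show ?thesis
      using *[rule_format, OF zC near] LJ LJ[of 0, unfolded z0] by (intro disjI2) simp
  qed
  from extremum_two_parameters[OF var(1)[OF g] var(1)[OF L] var(2)[OF g] var(2)[OF L] T this]
  show ?thesis unfolding \<delta>_def .
qed

theorem theorem11:
  fixes a b A B \<alpha> \<beta> l ya yb :: real
    and L g :: "real \<times> real \<times> real \<times> real \<Rightarrow> real"
    and N :: "(real \<Rightarrow> real) \<Rightarrow> real"
    and C :: "(real \<Rightarrow> real) set"
    and y :: "real \<Rightarrow> real"
  assumes "a \<le> A" "A < B" "B \<le> b"
    and "0 < \<alpha>" "\<alpha> < 1" "0 < \<beta>" "\<beta> < 1"
    and "C2_on (strip a b) L" "C2_on (strip a b) g"
    and "left_present a b L g \<longrightarrow> ya = 0"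
    and "right_present a b L g \<longrightarrow> yb = 0"
    and "norm_on a b (admissible \<alpha> \<beta> a b L g) N"
    and "C = {z \<in> admissible \<alpha> \<beta> a b L g.
               z a = ya \<and> z b = yb \<and> functional \<alpha> \<beta> a b A B g z = l}"
    and "local_minimizer N C (functional \<alpha> \<beta> a b A B L) y
         \<or> local_maximizer N C (functional \<alpha> \<beta> a b A B L) y"
    and "regular_along \<alpha> \<beta> a b L y" "regular_along \<alpha> \<beta> a b g y"
  shows "\<exists>\<mu>0 \<mu> :: real. (\<mu>0 \<noteq> 0 \<or> \<mu> \<noteq> 0) \<and>
    (let K = (\<lambda>p. \<mu>0 * L p - \<mu> * g p);
         Ky = (\<lambda>x. partial (strip a b) dir_y K (along \<alpha> \<beta> a b y x));
         Ku = (\<lambda>x. partial (strip a b) dir_u K (along \<alpha> \<beta> a b y x));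
         Kv = (\<lambda>x. partial (strip a b) dir_v K (along \<alpha> \<beta> a b y x))
     in
       (\<forall>x\<in>{A<..<B}. right_RL_exists \<alpha> A B Ku x \<and> left_RL_exists \<beta> A B Kv x)
       \<and> vanishes_on A B (\<lambda>x. Ky x + right_RL \<alpha> A B Ku x + left_RL \<beta> A B Kv x)
       \<and> (\<forall>x\<in>{a<..<A}. right_RL_exists \<alpha> a B Ku x \<and> right_RL_exists \<alpha> a A Ku x)
       \<and> vanishes_on a A (\<lambda>x. right_RL \<alpha> a B Ku x - right_RL \<alpha> a A Ku x)
       \<and> (\<forall>x\<in>{B<..<b}. left_RL_exists \<beta> A b Kv x \<and> left_RL_exists \<beta> B b Kv x)
       \<and> vanishes_on B b (\<lambda>x. left_RL \<beta> A b Kv x - left_RL \<beta> B b Kv x))"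
proof -
  note ab = assms(1-3) and \<alpha> = assms(4,5) and \<beta> = assms(6,7)
  have "a < b" using ab by simp
  have C1: "C1_on (strip a b) L" "C1_on (strip a b) g"
    using assms(8,9) by (auto simp: C2_on_def)
  have yadm: "y \<in> admissible \<alpha> \<beta> a b L g"
    using assms(13,14) by (auto simp: local_minimizer_def local_maximizer_def)
  define q where "q = present_args \<alpha> \<beta> a b L g"
  define \<delta> where "\<delta> F r s = integral {A..B} (\<lambda>x. vgrad a b F (x, q y x) (q (bump r s) x))" for F r s
  have cross: "\<delta> g r s * \<delta> L r' s' = \<delta> g r' s' * \<delta> L r s"
    if "a \<le> r" "r < s" "s \<le> b" "a \<le> r'" "r' < s'" "s' \<le> b" for r s r' s'
    unfolding \<delta>_def q_def
    by (rule isoperimetric_variations[OF ab \<alpha> \<beta> C1 assms(12-14)])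
      (use that \<alpha> \<beta> in \<open>auto simp: bump_outside intro!: bump_admissible\<close>)
  \<comment> \<open>If the variation of the constraint vanishes on all bumps, \<open>g\<close> alone
    satisfies the equations: the abnormal case \<open>(0, 1)\<close>. Otherwise one bump with
    nonzero \<open>\<delta> g\<close> is fixed and its pair \<open>(\<delta> g, \<delta> L)\<close>
    serves as multipliers; \<open>cross\<close> is then the claim for any other bump, without
    division.\<close>
  obtain \<mu>0 \<mu> :: real where \<mu>: "\<mu>0 \<noteq> 0 \<or> \<mu> \<noteq> 0"
    and mult: "\<And>r s. a \<le> r \<Longrightarrow> r < s \<Longrightarrow> s \<le> b \<Longrightarrow> \<mu>0 * \<delta> L r s - \<mu> * \<delta> g r s = 0"
  proof (cases "\<forall>r s. a \<le> r \<longrightarrow> r < s \<longrightarrow> s \<le> b \<longrightarrow> \<delta> g r s = 0")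
    case True
    then show ?thesis by (intro that[of 0 1]) auto
  next
    case False
    then obtain r s where "a \<le> r" "r < s" "s \<le> b" "\<delta> g r s \<noteq> 0" by blast
    then show ?thesis
      using cross[of r s] by (intro that[of "\<delta> g r s" "\<delta> L r s"]) (auto simp: mult.commute)
  qed
  define K where "K = (\<lambda>p. \<mu>0 * L p - \<mu> * g p)"
  define Ky where "Ky = (\<lambda>x. partial (strip a b) dir_y K (along \<alpha> \<beta> a b y x))"
  define Ku where "Ku = (\<lambda>x. partial (strip a b) dir_u K (along \<alpha> \<beta> a b y x))"
  define Kv where "Kv = (\<lambda>x. partial (strip a b) dir_v K (along \<alpha> \<beta> a b y x))"
  \<comment> \<open>A direction \<open>(0, e)\<close> leaves \<open>x\<close> fixed, so the
    derivative is two-sided even over the edges of the strip. The form \<open>+ (- \<mu>)\<close> is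
    the one in the linearity lemmas for Riemann-Liouville derivatives.\<close>
  have Kpart: "partial (strip a b) (0, e) K (along \<alpha> \<beta> a b y x) =
      \<mu>0 * partial (strip a b) (0, e) L (along \<alpha> \<beta> a b y x) + (- \<mu>) * partial (strip a b) (0, e) g (along \<alpha> \<beta> a b y x)"
    if "x \<in> {a..b}" "(0::real, e) \<in> Basis" for e x
  proof -
    let ?p = "along \<alpha> \<beta> a b y x"
    have p: "?p \<in> strip a b" and U: "{t. ?p + t *\<^sub>R (0, e) \<in> strip a b} = UNIV"
      using that(1) by (auto simp: along_def zero_prod_def[symmetric])
    have "((\<lambda>t. K (?p + t *\<^sub>R (0, e))) has_real_derivative
        \<mu>0 * partial (strip a b) (0, e) L ?p - \<mu> * partial (strip a b) (0, e) g ?p) (at 0)"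
      unfolding K_def
      using C1_on_partial_derivative[OF C1(1) that(2) p] C1_on_partial_derivative[OF C1(2) that(2) p] unfolding U
      by (intro DERIV_diff DERIV_cmult)
    then have "vector_derivative (\<lambda>t. K (?p + t *\<^sub>R (0, e))) (at 0) =
        \<mu>0 * partial (strip a b) (0, e) L ?p - \<mu> * partial (strip a b) (0, e) g ?p"
      by (intro vector_derivative_at) (simp add: has_real_derivative_iff_has_vector_derivative)
    then show ?thesis unfolding partial_def U by (simp add: partial_def[symmetric])
  qed
  \<comment> \<open>An entry of \<open>along\<close> for an absent derivative may be discontinuous
    in \<open>x\<close>, so continuity is proved with \<open>present_args\<close> and then
    transferred.\<close>
  have pc: "continuous_on {a..b} (\<lambda>x. partial (strip a b) (0, e) F (along \<alpha> \<beta> a b y x))"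
    if "F = L \<or> F = g" "continuous_on (strip a b) (partial (strip a b) (0, e) F)" for F e
  proof (rule continuous_on_eq)
    show "continuous_on {a..b} (\<lambda>x. partial (strip a b) (0, e) F (x, q y x))"
      by (rule continuous_on_compose2[OF that(2)])
        (auto simp: q_def intro!: continuous_on_Pair continuous_on_id continuous_on_present_args[OF yadm])
    show "partial (strip a b) (0, e) F (x, q y x) = partial (strip a b) (0, e) F (along \<alpha> \<beta> a b y x)" if "x \<in> {a..b}" for x
      unfolding q_def by (rule present_args_along(2)) fact+
  qed
  note cont = C1_on_strip_continuous_partials
  have cL: "continuous_on {a..b} (\<lambda>x. partial (strip a b) dir_y L (along \<alpha> \<beta> a b y x))"
      "continuous_on {a..b} (\<lambda>x. partial (strip a b) dir_u L (along \<alpha> \<beta> a b y x))"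
      "continuous_on {a..b} (\<lambda>x. partial (strip a b) dir_v L (along \<alpha> \<beta> a b y x))"
    by (rule pc; use cont[OF C1(1)] in simp)+
  have cg: "continuous_on {a..b} (\<lambda>x. partial (strip a b) dir_y g (along \<alpha> \<beta> a b y x))"
      "continuous_on {a..b} (\<lambda>x. partial (strip a b) dir_u g (along \<alpha> \<beta> a b y x))"
      "continuous_on {a..b} (\<lambda>x. partial (strip a b) dir_v g (along \<alpha> \<beta> a b y x))"
    by (rule pc; use cont[OF C1(2)] in simp)+
  have Klin: "continuous_on {a..b} (\<lambda>x. partial (strip a b) (0, e) K (along \<alpha> \<beta> a b y x))"
    if e: "(0::real, e) \<in> Basis"
      and c: "continuous_on {a..b} (\<lambda>x. partial (strip a b) (0, e) L (along \<alpha> \<beta> a b y x))"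
        "continuous_on {a..b} (\<lambda>x. partial (strip a b) (0, e) g (along \<alpha> \<beta> a b y x))" for e
  proof (rule continuous_on_eq)
    show "continuous_on {a..b} (\<lambda>x. \<mu>0 * partial (strip a b) (0, e) L (along \<alpha> \<beta> a b y x) +
        (- \<mu>) * partial (strip a b) (0, e) g (along \<alpha> \<beta> a b y x))"
      by (intro continuous_on_add continuous_on_mult continuous_on_const c)
  qed (simp only: Kpart[OF _ e])
  have Kc: "continuous_on {a..b} Ky" "continuous_on {a..b} Ku" "continuous_on {a..b} Kv"
    unfolding Ky_def Ku_def Kv_def
    using Klin[OF dir_Basis(2) cL(1) cg(1)] Klin[OF dir_Basis(3) cL(2) cg(2)] Klin[OF dir_Basis(4) cL(3) cg(3)]
    by blast+
  have Kur: "continuous_right_RL \<alpha> a b Ku"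
    unfolding Ku_def
    using assms(15,16) unfolding regular_along_def
    by (intro continuous_right_RL_cong[OF \<alpha>(2) \<open>a < b\<close> right_RL_linear(1)[OF \<alpha> \<open>a < b\<close> cL(2) _ cg(2)] Kpart[OF _ dir_Basis(3), symmetric]])
      auto
  have Kvl: "continuous_left_RL \<beta> a b Kv"
    unfolding Kv_def
    using assms(15,16) unfolding regular_along_def
    by (intro continuous_left_RL_cong[OF \<beta>(2) \<open>a < b\<close> left_RL_linear(1)[OF \<beta> \<open>a < b\<close> cL(3) _ cg(3)] Kpart[OF _ dir_Basis(4), symmetric]])
      auto
  have var: "integral {A..B} (\<lambda>x. Ky x * bump r s x + Ku x * left_RL \<alpha> a b (bump r s) x + Kv x * right_RL \<beta> a b (bump r s) x) = 0"
    if rs: "a \<le> r" "r < s" "s \<le> b" for r s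
  proof -
    have int: "(\<lambda>x. vgrad a b F (x, q y x) (q (bump r s) x)) integrable_on {A..B}" if "C1_on (strip a b) F" for F
    proof -
      have "continuous_on {a..b} (\<lambda>x. vgrad a b F (x, q y x))"
        by (rule continuous_on_compose2[OF continuous_on_vgrad[OF that]])
          (auto simp: q_def intro!: continuous_on_Pair continuous_on_id continuous_on_present_args[OF yadm])
      moreover have "continuous_on {a..b} (q (bump r s))"
        unfolding q_def by (intro continuous_on_present_args bump_admissible \<alpha> \<beta> rs)
      ultimately have "continuous_on {a..b} (\<lambda>x. vgrad a b F (x, q y x) (q (bump r s) x))"
        by (rule blinfun.continuous_on)
      then have "continuous_on {A..B} (\<lambda>x. vgrad a b F (x, q y x) (q (bump r s) x))"
        by (rule continuous_on_subset) (use ab in auto)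
      then show ?thesis by (rule integrable_continuous_interval)
    qed
    \<comment> \<open>For an absent derivative, \<open>q\<close> puts 0 where the right-hand side
      has the actual derivative of the bump; the accompanying partial derivative of \<open>F\<close>
      is 0, so both sides agree.\<close>
    have vg: "vgrad a b F (x, q y x) (q (bump r s) x) =
        bump r s x * partial (strip a b) dir_y F (along \<alpha> \<beta> a b y x) +
        left_RL \<alpha> a b (bump r s) x * partial (strip a b) dir_u F (along \<alpha> \<beta> a b y x) +
        right_RL \<beta> a b (bump r s) x * partial (strip a b) dir_v F (along \<alpha> \<beta> a b y x)"
      if F: "F = L \<or> F = g" and x: "x \<in> {a..b}" for F x
    proof -
      have "partial (strip a b) dir_u F (x, w) = 0" if "\<not> left_present a b L g" for w
        using not_depends_on_strip_partial_zero[of a b "(0, 1, 0)" F x w] that F x by (auto simp: left_present_def)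
      moreover have "partial (strip a b) dir_v F (x, w) = 0" if "\<not> right_present a b L g" for w
        using not_depends_on_strip_partial_zero[of a b "(0, 0, 1)" F x w] that F x by (auto simp: right_present_def)
      ultimately show ?thesis
        unfolding present_args_along(2)[OF F x, symmetric] q_def[symmetric]
        by (simp add: q_def present_args_def[of _ _ _ _ _ _ "bump r s"] vgrad_apply)
    qed
    have "integral {A..B} (\<lambda>x. Ky x * bump r s x + Ku x * left_RL \<alpha> a b (bump r s) x + Kv x * right_RL \<beta> a b (bump r s) x) =
      integral {A..B} (\<lambda>x. \<mu>0 * vgrad a b L (x, q y x) (q (bump r s) x) - \<mu> * vgrad a b g (x, q y x) (q (bump r s) x))"
    proof (rule Henstock_Kurzweil_Integration.integral_cong)
      fix x assume "x \<in> {A..B}"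
      then have x: "x \<in> {a..b}" using ab by auto
      show "Ky x * bump r s x + Ku x * left_RL \<alpha> a b (bump r s) x + Kv x * right_RL \<beta> a b (bump r s) x =
          \<mu>0 * vgrad a b L (x, q y x) (q (bump r s) x) - \<mu> * vgrad a b g (x, q y x) (q (bump r s) x)"
        unfolding Ky_def Ku_def Kv_def Kpart[OF x dir_Basis(2)] Kpart[OF x dir_Basis(3)] Kpart[OF x dir_Basis(4)]
          vg[OF disjI1[OF refl] x] vg[OF disjI2[OF refl] x]
        by (simp add: algebra_simps)
    qed
    also have "\<dots> = \<mu>0 * \<delta> L r s - \<mu> * \<delta> g r s"
      unfolding \<delta>_def
      by (subst Henstock_Kurzweil_Integration.integral_diff) (auto intro!: integrable_on_mult_right int C1)
    finally show ?thesis using mult[OF rs] by simp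
  qed
  note EL = euler_lagrange_of_variation[OF ab \<alpha> \<beta> Kc(1) Kc(2) Kur Kc(3) Kvl var]
  have ex: "\<forall>x\<in>{A<..<B}. right_RL_exists \<alpha> A B Ku x \<and> left_RL_exists \<beta> A B Kv x"
    using right_RL_truncated(1)[OF \<alpha> ab Kc(2) Kur] left_RL_truncated(1)[OF \<beta> ab Kc(3) Kvl] by blast
  have exl: "\<forall>x\<in>{a<..<A}. right_RL_exists \<alpha> a B Ku x \<and> right_RL_exists \<alpha> a A Ku x"
  proof
    fix x assume x: "x \<in> {a<..<A}"
    then have "a < B" "a < A" "A \<le> b" "x \<in> {a<..<B}" using ab by auto
    then show "right_RL_exists \<alpha> a B Ku x \<and> right_RL_exists \<alpha> a A Ku x"
      using x ab(3) right_RL_truncated(1)[OF \<alpha> order_refl _ _ Kc(2) Kur] by blast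
  qed
  have exr: "\<forall>x\<in>{B<..<b}. left_RL_exists \<beta> A b Kv x \<and> left_RL_exists \<beta> B b Kv x"
  proof
    fix x assume x: "x \<in> {B<..<b}"
    then have "A < b" "B < b" "a \<le> B" "x \<in> {A<..<b}" using ab by auto
    then show "left_RL_exists \<beta> A b Kv x \<and> left_RL_exists \<beta> B b Kv x"
      using x ab(1) left_RL_truncated(1)[OF \<beta> _ _ order_refl Kc(3) Kvl] by blast
  qed
  \<comment> \<open>Single terms of the equations may be unbounded near the end points, but each sum
    is identically 0 inside, so its limits there are 0.\<close>
  have "(\<mu>0 \<noteq> 0 \<or> \<mu> \<noteq> 0) \<and>
      (\<forall>x\<in>{A<..<B}. right_RL_exists \<alpha> A B Ku x \<and> left_RL_exists \<beta> A B Kv x)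
       \<and> vanishes_on A B (\<lambda>x. Ky x + right_RL \<alpha> A B Ku x + left_RL \<beta> A B Kv x)
       \<and> (\<forall>x\<in>{a<..<A}. right_RL_exists \<alpha> a B Ku x \<and> right_RL_exists \<alpha> a A Ku x)
       \<and> vanishes_on a A (\<lambda>x. right_RL \<alpha> a B Ku x - right_RL \<alpha> a A Ku x)
       \<and> (\<forall>x\<in>{B<..<b}. left_RL_exists \<beta> A b Kv x \<and> left_RL_exists \<beta> B b Kv x)
       \<and> vanishes_on B b (\<lambda>x. left_RL \<beta> A b Kv x - left_RL \<beta> B b Kv x)"
    by (intro conjI \<mu> ex exl exr vanishes_onI EL)
  then show ?thesis
    unfolding Let_def Ky_def Ku_def Kv_def K_def by - (rule exI[of _ \<mu>0], rule exI[of _ \<mu>], assumption)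
qed

end
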